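(* Let $y_1<y_2$, let $X_1,\dots,X_n$ be iid uniform on $(y_1,y_2)$, let $c\in(0,1)$, and let $\rho_{n,2}(\tau,c)$ be the relative density of the central similarity proximity catch digraph on these points with expansion parameter $\tau$ and centrality parameter $c$. For $\tau\in(0,\infty)$, as $n\to\infty$, $$\sqrt n\,[\rho_{n,2}(\tau,c)-\mu(\tau,c)]\to\mathcal N(0,4\,\nu(\tau,c))\quad\text{in law},$$ where $\mu(\tau,c)=\mu_1(\tau,c)$ and $\nu(\tau,c)=\nu_1(\tau,c)$ for $0<c\le1/2$, while $\mu(\tau,c)=\mu_2(\tau,c)$ and $\nu(\tau,c)=\nu_2(\tau,c)$ for $1/2\le c<1$. For $0<c\le1/2$, $$\mu_1(\tau,c)=\begin{cases}\dfrac{\tau}{2} & 0<\tau<1,\\[2mm] \dfrac{\tau\,(1+2c(\tau-1)(1-c))}{2(c\tau-c+1)(\tau+c-c\tau)} & \tau\ge1,\end{cases}\qquad 4\,\nu_1(\tau,c)=\begin{cases}\kappa_1(\tau,c) & 0<\tau<1,\\ \kappa_2(\tau,c) & \tau\ge1,\end{cases}$$ where $$\kappa_1(\tau,c)=\frac{\tau^2\left(c^2\tau^3-3c^2\tau^2-c\tau^3+2c^2\tau+3c\tau^2-c^2-2c\tau-\tau^2+c+\tau\right)}{3(c\tau-c+1)(c+\tau-c\tau)}$$ and $$\kappa_2(\tau,c)=\frac{c(1-c)\,Q(\tau,c)}{3(c\tau-c+1)^3(c\tau-c-\tau)^3},$$ $$\begin{aligned}Q(\tau,c)=\;&2c^4\tau^5-7c^4\tau^4-4c^3\tau^5+8c^4\tau^3+14c^3\tau^4+3c^2\tau^5-2c^4\tau^2-16c^3\tau^3-7c^2\tau^4-c\tau^5\\&-2c^4\tau+4c^3\tau^2+12c^2\tau^3+c^4+4c^3\tau-6c^2\tau^2-4c\tau^3-2c^3-3c^2\tau+4c\tau^2+c^2+c\tau-\tau^2.\end{aligned}$$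 For $1/2\le c<1$, $\mu_2(\tau,c)=\mu_1(\tau,1-c)$ and $\nu_2(\tau,c)=\nu_1(\tau,1-c)$.
   Context: $\mathcal N(\mu,\sigma^2)$ is the normal distribution with mean $\mu$ and variance $\sigma^2$. With $M_c=y_1+c(y_2-y_1)$, the central similarity proximity region of $x\in(y_1,y_2)$ is $$N(x,\tau,c)=\begin{cases}\left(x-\tau(x-y_1),\,x+\frac{\tau(1-c)(x-y_1)}{c}\right)\cap(y_1,y_2) & x\in(y_1,M_c),\\ \left(x-\frac{c\tau(y_2-x)}{1-c},\,x+\tau(y_2-x)\right)\cap(y_1,y_2) & x\in(M_c,y_2),\end{cases}$$ and at $x=M_c$ it is arbitrarily one of the two expressions. The digraph has vertex set $\{X_1,\dots,X_n\}$ and an arc $(X_i,X_j)$, $i\ne j$, iff $X_j\in N(X_i,\tau,c)$. Its relative density is the number of arcs divided by $n(n-1)$. *)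

theory Defs
  imports "HOL-Probability.Probability" "Graph_Theory.Pair_Digraph"
begin

(* The Boolean selects the expression used at the centre x = M_c, where the choice is arbitrary
   (the two in fact coincide there). The region is only meaningful for x in (y1, y2). *)
definition cs_region :: "bool \<Rightarrow> real \<Rightarrow> real \<Rightarrow> real \<Rightarrow> real \<Rightarrow> real \<Rightarrow> real set" where
  "cs_region left_at_centre y1 y2 \<tau> c x =
    (let M\<^sub>c = y1 + c * (y2 - y1) in
     if y1 < x \<and> (x < M\<^sub>c \<or> x = M\<^sub>c \<and> left_at_centre) then
       {x - \<tau> * (x - y1) <..< x + \<tau> * (1 - c) * (x - y1) / c} \<inter> {y1<..<y2}
     else if x < y2 \<and> (M\<^sub>c < x \<or> x = M\<^sub>c \<and> \<not> left_at_centre) then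
       {x - c * \<tau> * (y2 - x) / (1 - c) <..< x + \<tau> * (y2 - x)} \<inter> {y1<..<y2}
     else {})"

(* The vertex representing the point P i is its index i, so that the vertices stay distinct
   on the null event that two random points coincide. *)
definition cs_pcd ::
  "bool \<Rightarrow> real \<Rightarrow> real \<Rightarrow> real \<Rightarrow> real \<Rightarrow> nat \<Rightarrow> (nat \<Rightarrow> real) \<Rightarrow> nat pair_pre_digraph" where
  "cs_pcd left_at_centre y1 y2 \<tau> c n P =
    \<lparr> pverts = {..<n},
      parcs = {(i, j). i < n \<and> j < n \<and> i \<noteq> j \<and> P j \<in> cs_region left_at_centre y1 y2 \<tau> c (P i)} \<rparr>"

definition relative_density :: "'a pair_pre_digraph \<Rightarrow> real" where
  "relative_density G =
    real (card (parcs G)) / (real (card (pverts G)) * (real (card (pverts G)) - 1))"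

definition cs_mu1 :: "real \<Rightarrow> real \<Rightarrow> real" where
  "cs_mu1 \<tau> c =
    (if \<tau> < 1 then \<tau> / 2
     else \<tau> * (1 + 2 * c * (\<tau> - 1) * (1 - c)) / (2 * (c * \<tau> - c + 1) * (\<tau> + c - c * \<tau>)))"

definition cs_mu2 :: "real \<Rightarrow> real \<Rightarrow> real" where
  "cs_mu2 \<tau> c = cs_mu1 \<tau> (1 - c)"

definition cs_kappa1 :: "real \<Rightarrow> real \<Rightarrow> real" where
  "cs_kappa1 \<tau> c =
    \<tau>^2 * (c^2 * \<tau>^3 - 3 * c^2 * \<tau>^2 - c * \<tau>^3 + 2 * c^2 * \<tau> + 3 * c * \<tau>^2
           - c^2 - 2 * c * \<tau> - \<tau>^2 + c + \<tau>)
    / (3 * (c * \<tau> - c + 1) * (c + \<tau> - c * \<tau>))"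

definition cs_Q :: "real \<Rightarrow> real \<Rightarrow> real" where
  "cs_Q \<tau> c =
     2 * c^4 * \<tau>^5 - 7 * c^4 * \<tau>^4 - 4 * c^3 * \<tau>^5 + 8 * c^4 * \<tau>^3 + 14 * c^3 * \<tau>^4
     + 3 * c^2 * \<tau>^5 - 2 * c^4 * \<tau>^2 - 16 * c^3 * \<tau>^3 - 7 * c^2 * \<tau>^4 - c * \<tau>^5
     - 2 * c^4 * \<tau> + 4 * c^3 * \<tau>^2 + 12 * c^2 * \<tau>^3 + c^4 + 4 * c^3 * \<tau> - 6 * c^2 * \<tau>^2
     - 4 * c * \<tau>^3 - 2 * c^3 - 3 * c^2 * \<tau> + 4 * c * \<tau>^2 + c^2 + c * \<tau> - \<tau>^2"

definition cs_kappa2 :: "real \<Rightarrow> real \<Rightarrow> real" where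
  "cs_kappa2 \<tau> c =
    c * (1 - c) * cs_Q \<tau> c / (3 * (c * \<tau> - c + 1)^3 * (c * \<tau> - c - \<tau>)^3)"

(* kappa1 and kappa2 are formulas for 4 * nu1. *)
definition cs_nu1 :: "real \<Rightarrow> real \<Rightarrow> real" where
  "cs_nu1 \<tau> c = (if \<tau> < 1 then cs_kappa1 \<tau> c else cs_kappa2 \<tau> c) / 4"

definition cs_nu2 :: "real \<Rightarrow> real \<Rightarrow> real" where
  "cs_nu2 \<tau> c = cs_nu1 \<tau> (1 - c)"

definition cs_mu :: "real \<Rightarrow> real \<Rightarrow> real" where
  "cs_mu \<tau> c = (if c \<le> 1 / 2 then cs_mu1 \<tau> c else cs_mu2 \<tau> c)"

definition cs_nu :: "real \<Rightarrow> real \<Rightarrow> real" where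
  "cs_nu \<tau> c = (if c \<le> 1 / 2 then cs_nu1 \<tau> c else cs_nu2 \<tau> c)"

(* The ranges 0 < c <= 1/2 and 1/2 <= c < 1 overlap at c = 1/2, where they agree. *)
lemma cs_mu_upper:
  assumes "1 / 2 \<le> c" shows "cs_mu \<tau> c = cs_mu2 \<tau> c"
proof (cases "c = 1 / 2")
  case True
  show ?thesis by (simp add: True cs_mu_def cs_mu2_def)
next
  case False
  with assms show ?thesis by (simp add: cs_mu_def)
qed

lemma cs_nu_upper:
  assumes "1 / 2 \<le> c" shows "cs_nu \<tau> c = cs_nu2 \<tau> c"
proof (cases "c = 1 / 2")
  case True
  show ?thesis by (simp add: True cs_nu_def cs_nu2_def)
next
  case False
  with assms show ?thesis by (simp add: cs_nu_def)
qed

end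

theory Submission
  imports Defs "HOL-Real_Asymp.Real_Asymp"
begin

text \<open>
  The relative density is a U-statistic of degree two whose (asymmetric) kernel \<open>k x y\<close> indicates
  \<open>y \<in> N(x)\<close>. By Hoeffding's decomposition, \<open>\<surd>n\<close> times the centred density is the normalised
  sum of the i.i.d. variables \<open>E k(X\<^sub>i, Y) + E k(Y, X\<^sub>i) - 2\<mu>\<close> plus a sum over pairs of a degenerate
  kernel; the summands of the latter are orthogonal unless the two pairs agree as sets, so it vanishes
  in \<open>L\<^sup>2\<close>, and the central limit theorem applies. After rescaling to the unit interval,
  the points \<open>z\<close> with \<open>x \<in> N(z)\<close> form an interval up to the centre \<open>c\<close>, so both conditional
  means are piecewise affine; integrating their sum and its square over the pieces gives \<open>\<mu>\<close> and
  \<open>4\<nu>\<close>. The variance is positive because that sum is strictly increasing near \<open>0\<close>.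
\<close>

section \<open>Weak convergence and centred sums\<close>

text \<open>Before truncation to (0,1), the region of the centre \<open>c\<close> runs from
  \<open>1 - v\<close> to \<open>u\<close>, where \<open>u = c + \<tau> * (1 - c)\<close> and
  \<open>v = 1 - c + \<tau> * c\<close>; these are the factors of the denominators in the stated
  formulas. For \<tau> < 1 the points \<open>1 - v\<close>, \<open>c\<close>, \<open>u\<close> are
  the breakpoints of the sum of the conditional means. For \<tau> \<ge> 1 that interval covers
  (0,1), and the breakpoints are \<open>c / u\<close> and \<open>1 - (1 - c) / v\<close>, between
  which every region fills (0,1). The obstacle is the algebra: coefficients of the affine pieces
  lead to unwieldy rational functions. The integrals are therefore expressed by the values at the
  breakpoints, which are short, and clearing powers of \<open>u\<close> and \<open>v\<close> leaves
  a polynomial identity in \<tau> and \<open>c\<close>. Reflecting the unit interval exchanges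
  \<open>c\<close> with \<open>1 - c\<close> and \<open>u\<close> with \<open>v\<close>; the
  formulas inherit this symmetry, so both ranges of \<open>c\<close> are handled at once.\<close>

lemma (in prob_space) expectation_abs_le_sqrt_expectation_square:
  fixes R :: "'a \<Rightarrow> real"
  assumes "R \<in> borel_measurable M" "integrable M (\<lambda>\<omega>. (R \<omega>)\<^sup>2)"
  shows "expectation (\<lambda>\<omega>. \<bar>R \<omega>\<bar>) \<le> sqrt (expectation (\<lambda>\<omega>. (R \<omega>)\<^sup>2))"
proof -
  have int: "integrable M (\<lambda>\<omega>. \<bar>R \<omega>\<bar>)"
    using square_integrable_imp_integrable[OF assms] by auto
  have "0 \<le> variance (\<lambda>\<omega>. \<bar>R \<omega>\<bar>)" by simp
  also have "\<dots> = expectation (\<lambda>\<omega>. (R \<omega>)\<^sup>2) - (expectation (\<lambda>\<omega>. \<bar>R \<omega>\<bar>))\<^sup>2"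
    by (subst variance_eq) (use int assms in auto)
  finally show ?thesis
    by (intro real_le_rsqrt) simp
qed

text \<open>A Slutsky-type statement: \<open>iexp\<close> is 1-Lipschitz, so adding
  \<open>R n\<close> moves the characteristic function at \<open>t\<close> by at most |t| times the
  first absolute moment of \<open>R n\<close>.\<close>

lemma (in prob_space) weak_conv_m_add_null:
  fixes Y R :: "nat \<Rightarrow> 'a \<Rightarrow> real"
  assumes Y [measurable]: "\<And>n. random_variable borel (Y n)"
    and R: "\<And>n. integrable M (R n)"
    and conv: "weak_conv_m (\<lambda>n. distr M borel (Y n)) \<nu>"
    and \<nu>: "real_distribution \<nu>"
    and null: "(\<lambda>n. expectation (\<lambda>\<omega>. \<bar>R n \<omega>\<bar>)) \<longlonglongrightarrow> 0"
  shows "weak_conv_m (\<lambda>n. distr M borel (\<lambda>\<omega>. Y n \<omega> + R n \<omega>)) \<nu>"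
proof (rule levy_continuity)
  have [measurable]: "random_variable borel (R n)" for n
    using R by (rule borel_measurable_integrable)
  show "real_distribution (distr M borel (\<lambda>\<omega>. Y n \<omega> + R n \<omega>))" for n
    by simp
  show "real_distribution \<nu>" by fact
  fix t :: real
  have lim: "(\<lambda>n. char (distr M borel (Y n)) t) \<longlonglongrightarrow> char \<nu> t"
    by (rule levy_continuity1[OF _ \<nu> conv]) simp
  have bound: "norm (char (distr M borel (\<lambda>\<omega>. Y n \<omega> + R n \<omega>)) t - char (distr M borel (Y n)) t)
      \<le> \<bar>t\<bar> * expectation (\<lambda>\<omega>. \<bar>R n \<omega>\<bar>)" for n
  proof -
    have "char (distr M borel (\<lambda>\<omega>. Y n \<omega> + R n \<omega>)) t - char (distr M borel (Y n)) t
        = (CLINT \<omega>|M. iexp (t * (Y n \<omega> + R n \<omega>)) - iexp (t * Y n \<omega>))"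
      unfolding char_def
      by (subst (1 2) integral_distr, simp, simp, simp, simp,
          subst Bochner_Integration.integral_diff) (auto intro!: integrable_iexp)
    also have "norm \<dots> \<le> expectation (\<lambda>\<omega>.
        norm (iexp (t * (Y n \<omega> + R n \<omega>)) - iexp (t * Y n \<omega>)))"
      by (rule integral_norm_bound)
    also have "\<dots> \<le> expectation (\<lambda>\<omega>. \<bar>t\<bar> * \<bar>R n \<omega>\<bar>)"
    proof (rule integral_mono)
      fix \<omega>
      have "norm (iexp (t * (Y n \<omega> + R n \<omega>)) - iexp (t * Y n \<omega>))
          = norm (iexp (t * Y n \<omega>) * (iexp (t * R n \<omega>) - 1))"
        by (simp add: algebra_simps exp_add[symmetric])
      also have "\<dots> = norm (iexp (t * R n \<omega>) - 1)"
        by (simp add: norm_mult del: of_real_mult)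
      also have "\<dots> \<le> \<bar>t * R n \<omega>\<bar>"
        using iexp_approx1[of "t * R n \<omega>" 0] by simp
      finally show "norm (iexp (t * (Y n \<omega> + R n \<omega>)) - iexp (t * Y n \<omega>)) \<le> \<bar>t\<bar> * \<bar>R n \<omega>\<bar>"
        by (simp add: abs_mult)
    qed (auto intro!: integrable_iexp Bochner_Integration.integrable_diff R)
    finally show ?thesis by simp
  qed
  have "(\<lambda>n. \<bar>t\<bar> * expectation (\<lambda>\<omega>. \<bar>R n \<omega>\<bar>)) \<longlonglongrightarrow> 0"
    using tendsto_mult_right_zero[OF null] by simp
  then have "(\<lambda>n. char (distr M borel (\<lambda>\<omega>. Y n \<omega> + R n \<omega>)) t
      - char (distr M borel (Y n)) t) \<longlonglongrightarrow> 0"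
    by (rule Lim_null_comparison[rotated]) (use bound in auto)
  from tendsto_add[OF this lim]
  show "(\<lambda>n. char (distr M borel (\<lambda>\<omega>. Y n \<omega> + R n \<omega>)) t) \<longlonglongrightarrow> char \<nu> t"
    by simp
qed

lemma distr_std_normal_scale:
  assumes "0 < \<sigma>"
  shows "distr std_normal_distribution borel (\<lambda>x. \<sigma> * x) = density lborel (normal_density 0 \<sigma>)"
proof -
  interpret prob_space std_normal_distribution
    by (rule prob_space_normal_density) simp
  have "distributed std_normal_distribution lborel (\<lambda>x. x) std_normal_density"
    unfolding distributed_def by (auto simp: distr_id2)
  from normal_density_affine[OF this, of \<sigma> 0] assms
  have "distr std_normal_distribution lborel (\<lambda>x. \<sigma> * x) = density lborel (normal_density 0 \<sigma>)"
    by (auto simp: distributed_def)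
  then show ?thesis
    by (simp cong: distr_cong)
qed

text \<open>The standardised sum evaluated at \<open>\<sigma> * t\<close> has the characteristic
  function of the sum over \<open>sqrt (real n)\<close> at \<open>t\<close>; the same scaling turns
  the standard normal law into the one with standard deviation \<sigma>.\<close>

lemma (in prob_space) central_limit_theorem_centered:
  fixes Y :: "nat \<Rightarrow> 'a \<Rightarrow> real"
  assumes indep: "indep_vars (\<lambda>_. borel) Y UNIV"
    and mean: "\<And>n. expectation (Y n) = 0"
    and "0 < \<sigma>"
    and sq: "\<And>n. integrable M (\<lambda>\<omega>. (Y n \<omega>)\<^sup>2)"
    and var: "\<And>n. expectation (\<lambda>\<omega>. (Y n \<omega>)\<^sup>2) = \<sigma>\<^sup>2"
    and dist: "\<And>n. distr M borel (Y n) = D"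
  shows "weak_conv_m (\<lambda>n. distr M borel (\<lambda>\<omega>. (\<Sum>i<n. Y i \<omega>) / sqrt (real n)))
    (density lborel (normal_density 0 \<sigma>))"
proof (rule levy_continuity)
  have [measurable]: "random_variable borel (Y n)" for n
    using indep unfolding indep_vars_def2 by simp
  show "real_distribution (distr M borel (\<lambda>\<omega>. (\<Sum>i<n. Y i \<omega>) / sqrt (real n)))" for n
    by simp
  show "real_distribution (density lborel (normal_density 0 \<sigma>))"
    using prob_space_normal_density[OF \<open>0 < \<sigma>\<close>, of 0]
    by (auto simp: real_distribution_def real_distribution_axioms_def)
  fix t :: real
  have wc: "weak_conv_m (\<lambda>n. distr M borel (\<lambda>\<omega>. (\<Sum>i<n. Y i \<omega>) / sqrt (n * \<sigma>\<^sup>2)))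
      std_normal_distribution"
    by (rule central_limit_theorem_zero_mean[OF indep mean \<open>0 < \<sigma>\<close> sq _ dist])
       (simp add: mean var)
  have "(\<lambda>n. char (distr M borel (\<lambda>\<omega>. (\<Sum>i<n. Y i \<omega>) / sqrt (n * \<sigma>\<^sup>2))) (\<sigma> * t))
      \<longlonglongrightarrow> char std_normal_distribution (\<sigma> * t)"
    by (rule levy_continuity1[OF _ real_dist_normal_dist wc]) simp
  moreover have "char (distr M borel (\<lambda>\<omega>. (\<Sum>i<n. Y i \<omega>) / sqrt (n * \<sigma>\<^sup>2))) (\<sigma> * t)
      = char (distr M borel (\<lambda>\<omega>. (\<Sum>i<n. Y i \<omega>) / sqrt (real n))) t" for n
    using \<open>0 < \<sigma>\<close>
    by (simp add: char_def integral_distr real_sqrt_mult mult_ac)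
  moreover have "char std_normal_distribution (\<sigma> * t)
      = char (density lborel (normal_density 0 \<sigma>)) t"
    unfolding distr_std_normal_scale[OF \<open>0 < \<sigma>\<close>, symmetric]
    by (simp add: char_def integral_distr mult_ac)
  ultimately show "(\<lambda>n. char (distr M borel (\<lambda>\<omega>. (\<Sum>i<n. Y i \<omega>) / sqrt (real n))) t)
      \<longlonglongrightarrow> char (density lborel (normal_density 0 \<sigma>)) t"
    by simp
qed

section \<open>Averaging out one coordinate of an i.i.d. sequence\<close>

locale iid_sequence = prob_space M for M :: "'a measure" +
  fixes N :: "'b measure" and X :: "nat \<Rightarrow> 'a \<Rightarrow> 'b" and D :: "'b measure"
  assumes indep: "indep_vars (\<lambda>_. N) X UNIV"
    and distr_X: "\<And>i. distr M N (X i) = D"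
begin

lemma X_measurable [measurable]: "random_variable N (X i)"
  using indep unfolding indep_vars_def2 by simp

lemma sets_D [measurable_cong, simp]: "sets D = sets N"
  by (simp flip: distr_X[of 0])

lemma space_D [simp]: "space D = space N"
  by (simp flip: distr_X[of 0])

lemma prob_space_D: "prob_space D"
  by (simp flip: distr_X[of 0] add: prob_space_distr)

text \<open>The coordinates \<open>{i}\<close> and \<open>-{i}\<close> form independent blocks, so
  Fubini allows integrating over coordinate \<open>i\<close> first, where the hypothesis gives 0.
  The other three indices may coincide with one another, which is why they are read off one block;
  this covers index pairs that share an entry.\<close>

lemma expectation_eq_zero_if_centered:
  fixes f :: "'b \<Rightarrow> 'b \<times> 'b \<times> 'b \<Rightarrow> real"
  assumes meas [measurable]: "case_prod f \<in> borel_measurable (N \<Otimes>\<^sub>M (N \<Otimes>\<^sub>M N \<Otimes>\<^sub>M N))"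
    and bound: "\<And>x y. \<bar>f x y\<bar> \<le> B"
    and zero: "\<And>y. y \<in> space (N \<Otimes>\<^sub>M N \<Otimes>\<^sub>M N) \<Longrightarrow> (\<integral>x. f x y \<partial>D) = 0"
    and ne: "i \<noteq> j" "i \<noteq> k" "i \<noteq> l"
  shows "expectation (\<lambda>\<omega>. f (X i \<omega>) (X j \<omega>, X k \<omega>, X l \<omega>)) = 0"
proof -
  let ?Y = "\<lambda>\<omega>. (X j \<omega>, X k \<omega>, X l \<omega>)"
  let ?T = "N \<Otimes>\<^sub>M N \<Otimes>\<^sub>M N"
  let ?P1 = "PiM {i} (\<lambda>_. N)" and ?P2 = "PiM (-{i}) (\<lambda>_. N)"
  let ?r1 = "\<lambda>\<omega>. restrict (\<lambda>i. X i \<omega>) {i}" and ?r2 = "\<lambda>\<omega>. restrict (\<lambda>i. X i \<omega>) (-{i})"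
  define D1 where "D1 = distr M ?P1 ?r1"
  define D2 where "D2 = distr M ?P2 ?r2"
  have "indep_var ?P1 ?r1 ?P2 ?r2"
    by (rule indep_var_restrict[OF indep]) auto
  then have rv [measurable]: "random_variable ?P1 ?r1" "random_variable ?P2 ?r2"
    and joint: "D1 \<Otimes>\<^sub>M D2 = distr M (?P1 \<Otimes>\<^sub>M ?P2) (\<lambda>\<omega>. (?r1 \<omega>, ?r2 \<omega>))"
    by (simp_all add: indep_var_distribution_eq D1_def D2_def)
  interpret D1: prob_space D1 unfolding D1_def by (rule prob_space_distr) fact
  interpret D2: prob_space D2 unfolding D2_def by (rule prob_space_distr) fact
  interpret P: pair_prob_space D1 D2 ..
  have sets12 [measurable_cong]: "sets D1 = sets ?P1" "sets D2 = sets ?P2"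
    by (simp_all add: D1_def D2_def)
  have ev [measurable]: "(\<lambda>p. p i) \<in> measurable ?P1 N"
      "(\<lambda>q. (q j, q k, q l)) \<in> measurable ?P2 ?T"
    using ne by auto
  let ?g = "\<lambda>(p, q). f (p i) (q j, q k, q l)"
  have g [measurable]: "?g \<in> borel_measurable (?P1 \<Otimes>\<^sub>M ?P2)"
  proof -
    have "(\<lambda>z. case_prod f (fst z i, (snd z j, snd z k, snd z l))) \<in> borel_measurable (?P1 \<Otimes>\<^sub>M ?P2)"
      by (rule measurable_compose[OF _ meas], rule measurable_Pair)
         (use measurable_compose[OF measurable_fst ev(1)] measurable_compose[OF measurable_snd ev(2)] in auto)
    then show ?thesis by (simp add: case_prod_beta)
  qed
  have "integrable (D1 \<Otimes>\<^sub>M D2) ?g"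
    by (rule P.integrable_const_bound[of _ B]) (use bound in auto)
  have "expectation (\<lambda>\<omega>. f (X i \<omega>) (?Y \<omega>)) = expectation (\<lambda>\<omega>. ?g (?r1 \<omega>, ?r2 \<omega>))"
    using ne by simp
  also have "\<dots> = (\<integral>z. ?g z \<partial>(D1 \<Otimes>\<^sub>M D2))"
    unfolding joint by (subst integral_distr) auto
  also have "\<dots> = (\<integral>q. (\<integral>p. f (p i) (q j, q k, q l) \<partial>D1) \<partial>D2)"
    using P.integral_snd[OF \<open>integrable _ _\<close>] by simp
  also have "\<dots> = (\<integral>q. 0 \<partial>D2)"
  proof (rule Bochner_Integration.integral_cong[OF refl])
    fix q assume "q \<in> space D2"
    then have q: "(q j, q k, q l) \<in> space ?T"
      using measurable_space[OF ev(2)] by (simp add: D2_def)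
    have sec [measurable]: "(\<lambda>x. f x (q j, q k, q l)) \<in> borel_measurable N"
      using measurable_compose[OF measurable_Pair2'[OF q] meas] by simp
    have "(\<integral>p. f (p i) (q j, q k, q l) \<partial>D1) = expectation (\<lambda>\<omega>. f (X i \<omega>) (q j, q k, q l))"
      unfolding D1_def by (subst integral_distr) auto
    also have "\<dots> = (\<integral>x. f x (q j, q k, q l) \<partial>D)"
      unfolding distr_X[of i, symmetric] by (subst integral_distr) auto
    also have "\<dots> = 0" by (rule zero[OF q])
    finally show "(\<integral>p. f (p i) (q j, q k, q l) \<partial>D1) = 0" .
  qed
  finally show ?thesis by simp
qed

end

section \<open>The central limit theorem for U-statistics of degree two\<close>

text \<open>Ordered pairs, because the kernel is not symmetric: (i, j) stands for a possible arc
  from i to j.\<close>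

definition off_diagonal :: "nat \<Rightarrow> (nat \<times> nat) set" where
  "off_diagonal n = (SIGMA i:{..<n}. {..<n} - {i})"

lemma finite_off_diagonal [simp]: "finite (off_diagonal n)"
  by (simp add: off_diagonal_def)

lemma card_off_diagonal: "card (off_diagonal n) = n * (n - 1)"
  by (simp add: off_diagonal_def)

lemma off_diagonal_iff: "(i, j) \<in> off_diagonal n \<longleftrightarrow> i < n \<and> j < n \<and> i \<noteq> j"
  by (auto simp: off_diagonal_def)

lemma sum_off_diagonal_fst:
  fixes f :: "nat \<Rightarrow> real"
  shows "(\<Sum>(i, j)\<in>off_diagonal n. f i) = real (n - 1) * (\<Sum>i<n. f i)"
  unfolding off_diagonal_def
  by (subst sum.Sigma[symmetric]) (auto simp: sum_distrib_left intro!: sum.cong)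

lemma sum_off_diagonal_swap:
  fixes f :: "nat \<Rightarrow> nat \<Rightarrow> real"
  shows "(\<Sum>(i, j)\<in>off_diagonal n. f j i) = (\<Sum>(i, j)\<in>off_diagonal n. f i j)"
  by (rule sum.reindex_bij_witness[of _ prod.swap prod.swap]) (auto simp: off_diagonal_def)

text \<open>If \<open>f\<close> is not integrable, its integral is 0 by convention and
  \<open>0 \<le> B\<close> suffices. The bounds on the conditional means thus hold at every point,
  not only on the space of the measure.\<close>

lemma (in prob_space) abs_integral_le_const:
  fixes f :: "'a \<Rightarrow> real"
  assumes "\<And>x. \<bar>f x\<bar> \<le> B" "0 \<le> B"
  shows "\<bar>\<integral>x. f x \<partial>M\<bar> \<le> B"
proof (cases "integrable M f")
  case True
  have "\<bar>\<integral>x. f x \<partial>M\<bar> \<le> (\<integral>x. \<bar>f x\<bar> \<partial>M)" by (rule integral_abs_bound)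
  also have "\<dots> \<le> (\<integral>x. B \<partial>M)" using True assms by (intro integral_mono) auto
  finally show ?thesis by (simp add: prob_space)
next
  case False
  then show ?thesis using assms by (simp add: not_integrable_integral_eq)
qed

locale iid_kernel = iid_sequence M N X D
  for M :: "'a measure" and N :: "'b measure" and X :: "nat \<Rightarrow> 'a \<Rightarrow> 'b" and D :: "'b measure" +
  fixes k :: "'b \<Rightarrow> 'b \<Rightarrow> real"
  assumes k_measurable [measurable]: "case_prod k \<in> borel_measurable (N \<Otimes>\<^sub>M N)"
    and k_bound: "\<And>x y. \<bar>k x y\<bar> \<le> 1"
begin

sublocale D: prob_space D
  by (rule prob_space_D)

sublocale DD: pair_prob_space D D ..

lemma D_prob_space_N: "D.prob (space N) = 1"
  using D.prob_space by simp

definition row_mean :: "'b \<Rightarrow> real" where "row_mean x = (\<integral>y. k x y \<partial>D)"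
definition col_mean :: "'b \<Rightarrow> real" where "col_mean y = (\<integral>x. k x y \<partial>D)"
definition kernel_mean :: real where "kernel_mean = (\<integral>x. row_mean x \<partial>D)"

text \<open>The first-order term of Hoeffding's decomposition. Both conditional means enter because
  a sample point contributes as the tail and as the head of arcs.\<close>

definition projection :: "'b \<Rightarrow> real" where
  "projection x = row_mean x + col_mean x - 2 * kernel_mean"

text \<open>The part of the kernel that integrates to 0 in each argument separately, which is the
  source of the orthogonality between different pairs.\<close>

definition degenerate_part :: "'b \<Rightarrow> 'b \<Rightarrow> real" where
  "degenerate_part x y = k x y - row_mean x - col_mean y + kernel_mean"

text \<open>The denominator is written as in \<open>relative_density\<close>; for \<open>n\<close>
  at most 1 both quotients are 0 / 0 = 0, so they agree for every \<open>n\<close>.\<close>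

definition u_statistic :: "nat \<Rightarrow> 'a \<Rightarrow> real" where
  "u_statistic n \<omega> = (\<Sum>(i, j)\<in>off_diagonal n. k (X i \<omega>) (X j \<omega>)) / (real n * (real n - 1))"

lemma k_swap_measurable [measurable]: "(\<lambda>(y, x). k x y) \<in> borel_measurable (N \<Otimes>\<^sub>M N)"
proof -
  have "(\<lambda>z. case_prod k (snd z, fst z)) \<in> borel_measurable (N \<Otimes>\<^sub>M N)"
    by measurable
  then show ?thesis by (simp add: case_prod_beta)
qed

lemma row_mean_measurable [measurable]: "row_mean \<in> borel_measurable N"
proof -
  have "case_prod k \<in> borel_measurable (N \<Otimes>\<^sub>M D)" by measurable
  from D.borel_measurable_lebesgue_integral[OF this] show ?thesis
    by (simp add: row_mean_def[abs_def])
qed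

lemma col_mean_measurable [measurable]: "col_mean \<in> borel_measurable N"
proof -
  have "(\<lambda>(y, x). k x y) \<in> borel_measurable (N \<Otimes>\<^sub>M D)" by measurable
  from D.borel_measurable_lebesgue_integral[OF this] show ?thesis
    by (simp add: col_mean_def[abs_def])
qed

lemma row_mean_bound: "\<bar>row_mean x\<bar> \<le> 1"
  unfolding row_mean_def by (rule D.abs_integral_le_const) (auto simp: k_bound)

lemma col_mean_bound: "\<bar>col_mean x\<bar> \<le> 1"
  unfolding col_mean_def by (rule D.abs_integral_le_const) (auto simp: k_bound)

lemma kernel_mean_bound: "\<bar>kernel_mean\<bar> \<le> 1"
  unfolding kernel_mean_def by (rule D.abs_integral_le_const) (auto simp: row_mean_bound)

lemma integrable_row_mean: "integrable D row_mean"
  by (rule D.integrable_const_bound[of _ 1]) (auto simp: row_mean_bound)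

lemma integrable_col_mean: "integrable D col_mean"
  by (rule D.integrable_const_bound[of _ 1]) (auto simp: col_mean_bound)

text \<open>By Fubini one constant centres both conditional means.\<close>

lemma integral_col_mean: "(\<integral>y. col_mean y \<partial>D) = kernel_mean"
proof -
  have "integrable (D \<Otimes>\<^sub>M D) (case_prod k)"
    by (rule DD.integrable_const_bound[of _ 1]) (auto simp: k_bound)
  from DD.Fubini_integral[OF this] show ?thesis
    by (simp add: kernel_mean_def row_mean_def[abs_def] col_mean_def[abs_def])
qed

lemma integrable_row: "x \<in> space N \<Longrightarrow> integrable D (\<lambda>y. k x y)"
proof (rule D.integrable_const_bound[of _ 1])
  assume x: "x \<in> space N"
  show "(\<lambda>y. k x y) \<in> borel_measurable D"
    using measurable_compose[OF measurable_Pair1'[OF x] k_measurable] by simp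
qed (auto simp: k_bound)

lemma integrable_col: "y \<in> space N \<Longrightarrow> integrable D (\<lambda>x. k x y)"
proof (rule D.integrable_const_bound[of _ 1])
  assume y: "y \<in> space N"
  show "(\<lambda>x. k x y) \<in> borel_measurable D"
    using measurable_compose[OF measurable_Pair2'[OF y] k_measurable] by simp
qed (auto simp: k_bound)

lemma degenerate_part_measurable [measurable]:
  "case_prod degenerate_part \<in> borel_measurable (N \<Otimes>\<^sub>M N)"
  unfolding degenerate_part_def[abs_def] by measurable

lemma degenerate_part_bound: "\<bar>degenerate_part x y\<bar> \<le> 4"
  using k_bound[of x y] row_mean_bound[of x] col_mean_bound[of y] kernel_mean_bound
  unfolding degenerate_part_def by linarith

lemma integral_degenerate_part_fst:
  assumes "y \<in> space N"
  shows "(\<integral>x. degenerate_part x y \<partial>D) = 0"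
  unfolding degenerate_part_def
  using integrable_col[OF assms] integrable_row_mean
  by (simp add: D_prob_space_N col_mean_def[symmetric] kernel_mean_def[symmetric])

lemma integral_degenerate_part_snd:
  assumes "x \<in> space N"
  shows "(\<integral>y. degenerate_part x y \<partial>D) = 0"
  unfolding degenerate_part_def
  using integrable_row[OF assms] integrable_col_mean
  by (simp add: D_prob_space_N row_mean_def[symmetric] integral_col_mean)

lemma degenerate_part_X_measurable [measurable]:
  "random_variable borel (\<lambda>\<omega>. degenerate_part (X i \<omega>) (X j \<omega>))"
  using measurable_compose[OF measurable_Pair[OF X_measurable[of i] X_measurable[of j]]
      degenerate_part_measurable] by simp

lemma k_X_measurable [measurable]: "random_variable borel (\<lambda>\<omega>. k (X i \<omega>) (X j \<omega>))"
  using measurable_compose[OF measurable_Pair[OF X_measurable[of i] X_measurable[of j]]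
      k_measurable] by simp

lemma degenerate_product_bound:
  "\<bar>degenerate_part a b * degenerate_part c d\<bar> \<le> 16"
  using mult_mono[OF degenerate_part_bound[of a b] degenerate_part_bound[of c d]]
  by (simp add: abs_mult)

lemma integrable_degenerate_product:
  "integrable M (\<lambda>\<omega>. degenerate_part (X i \<omega>) (X j \<omega>) * degenerate_part (X p \<omega>) (X q \<omega>))"
  by (rule integrable_const_bound[of _ 16]) (auto simp: degenerate_product_bound)

lemma degenerate_part_orthogonal:
  assumes "i \<noteq> j" "p \<noteq> q" "(p, q) \<noteq> (i, j)" "(p, q) \<noteq> (j, i)"
  shows "expectation (\<lambda>\<omega>. degenerate_part (X i \<omega>) (X j \<omega>) * degenerate_part (X p \<omega>) (X q \<omega>)) = 0"
proof -
  let ?T = "N \<Otimes>\<^sub>M N \<Otimes>\<^sub>M N"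
  let ?d = degenerate_part
  \<comment> \<open>Some index of the first pair does not occur in the second; average over it.\<close>
  consider "i \<noteq> p" "i \<noteq> q" | "j \<noteq> p" "j \<noteq> q"
    using assms by auto
  then show ?thesis
  proof cases
    case 1
    let ?f = "\<lambda>x (y1, y2, y3). ?d x y1 * ?d y2 y3"
    have "(\<lambda>z. case_prod ?d (fst z, fst (snd z)) *
        case_prod ?d (fst (snd (snd z)), snd (snd (snd z)))) \<in> borel_measurable (N \<Otimes>\<^sub>M ?T)"
      by measurable
    then have "case_prod ?f \<in> borel_measurable (N \<Otimes>\<^sub>M ?T)"
      by (simp add: case_prod_beta)
    moreover have "\<bar>?f x y\<bar> \<le> 16" for x y
      by (cases y) (simp add: degenerate_product_bound)
    moreover have "(\<integral>x. ?f x y \<partial>D) = 0" if "y \<in> space ?T" for y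
      using that by (auto simp: space_pair_measure integral_degenerate_part_fst)
    ultimately show ?thesis
      using expectation_eq_zero_if_centered[of ?f 16 i j p q] 1 assms by simp
  next
    case 2
    let ?f = "\<lambda>x (y1, y2, y3). ?d y1 x * ?d y2 y3"
    have "(\<lambda>z. case_prod ?d (fst (snd z), fst z) *
        case_prod ?d (fst (snd (snd z)), snd (snd (snd z)))) \<in> borel_measurable (N \<Otimes>\<^sub>M ?T)"
      by measurable
    then have "case_prod ?f \<in> borel_measurable (N \<Otimes>\<^sub>M ?T)"
      by (simp add: case_prod_beta)
    moreover have "\<bar>?f x y\<bar> \<le> 16" for x y
      by (cases y) (simp add: degenerate_product_bound)
    moreover have "(\<integral>x. ?f x y \<partial>D) = 0" if "y \<in> space ?T" for y
      using that by (auto simp: space_pair_measure integral_degenerate_part_snd)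
    ultimately show ?thesis
      using expectation_eq_zero_if_centered[of ?f 16 j i p q] 2 assms by simp
  qed
qed

text \<open>The square expands into about n^4 terms, but for a fixed pair only the pair itself and
  its reversal survive. Each product is at most 4 * 4 = 16 in absolute value, hence 32 per pair; the
  total is only of order n^2.\<close>

lemma degenerate_sum_second_moment:
  "expectation (\<lambda>\<omega>. (\<Sum>(i, j)\<in>off_diagonal n. degenerate_part (X i \<omega>) (X j \<omega>))\<^sup>2)
     \<le> 32 * real (n * (n - 1))"
proof -
  let ?d = "\<lambda>e \<omega>. degenerate_part (X (fst e) \<omega>) (X (snd e) \<omega>)"
  let ?P = "off_diagonal n"
  have "expectation (\<lambda>\<omega>. (\<Sum>(i, j)\<in>?P. degenerate_part (X i \<omega>) (X j \<omega>))\<^sup>2)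
      = expectation (\<lambda>\<omega>. \<Sum>e\<in>?P. \<Sum>e'\<in>?P. ?d e \<omega> * ?d e' \<omega>)"
    by (simp add: case_prod_beta power2_eq_square sum_product)
  also have "\<dots> = (\<Sum>e\<in>?P. \<Sum>e'\<in>?P. expectation (\<lambda>\<omega>. ?d e \<omega> * ?d e' \<omega>))"
    by (simp add: Bochner_Integration.integral_sum integrable_degenerate_product)
  also have "\<dots> \<le> (\<Sum>e\<in>?P. 32)"
  proof (rule sum_mono)
    fix e assume e: "e \<in> ?P"
    have "(\<Sum>e'\<in>?P. expectation (\<lambda>\<omega>. ?d e \<omega> * ?d e' \<omega>))
        = (\<Sum>e'\<in>{e, prod.swap e}. expectation (\<lambda>\<omega>. ?d e \<omega> * ?d e' \<omega>))"
    proof (rule sum.mono_neutral_right)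
      show "{e, prod.swap e} \<subseteq> ?P" using e by (cases e) (auto simp: off_diagonal_iff)
      show "\<forall>e'\<in>?P - {e, prod.swap e}. expectation (\<lambda>\<omega>. ?d e \<omega> * ?d e' \<omega>) = 0"
      proof
        fix e' assume "e' \<in> ?P - {e, prod.swap e}"
        with e show "expectation (\<lambda>\<omega>. ?d e \<omega> * ?d e' \<omega>) = 0"
          by (cases e; cases e') (auto simp: off_diagonal_iff intro!: degenerate_part_orthogonal)
      qed
    qed simp
    also have "\<dots> \<le> (\<Sum>e'\<in>{e, prod.swap e}. 16)"
    proof (rule sum_mono)
      fix e'
      have "\<bar>expectation (\<lambda>\<omega>. ?d e \<omega> * ?d e' \<omega>)\<bar> \<le> 16"
        by (rule abs_integral_le_const) (auto simp: degenerate_product_bound)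
      then show "expectation (\<lambda>\<omega>. ?d e \<omega> * ?d e' \<omega>) \<le> 16" by simp
    qed
    also have "\<dots> \<le> 32"
      by (cases "e = prod.swap e") auto
    finally show "(\<Sum>e'\<in>?P. expectation (\<lambda>\<omega>. ?d e \<omega> * ?d e' \<omega>)) \<le> 32" .
  qed
  also have "\<dots> = 32 * real (n * (n - 1))"
    by (simp add: card_off_diagonal)
  finally show ?thesis .
qed

lemma hoeffding_decomposition:
  "(\<Sum>(i, j)\<in>off_diagonal n. k (X i \<omega>) (X j \<omega>))
     = (\<Sum>(i, j)\<in>off_diagonal n. degenerate_part (X i \<omega>) (X j \<omega>))
       + real (n - 1) * (\<Sum>i<n. projection (X i \<omega>)) + real (n * (n - 1)) * kernel_mean"
proof -
  have "(\<Sum>(i, j)\<in>off_diagonal n. k (X i \<omega>) (X j \<omega>))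
      = (\<Sum>(i, j)\<in>off_diagonal n. degenerate_part (X i \<omega>) (X j \<omega>))
        + (\<Sum>(i, j)\<in>off_diagonal n. row_mean (X i \<omega>) - kernel_mean)
        + (\<Sum>(i, j)\<in>off_diagonal n. col_mean (X j \<omega>) - kernel_mean)
        + (\<Sum>(i, j)\<in>off_diagonal n. kernel_mean)"
    unfolding sum.distrib[symmetric]
    by (rule sum.cong) (auto simp: degenerate_part_def)
  \<comment> \<open>After the swap the column mean depends on the first index too, so each index is
    counted \<open>n - 1\<close> times for both means.\<close>
  also have "(\<Sum>(i, j)\<in>off_diagonal n. col_mean (X j \<omega>) - kernel_mean)
      = (\<Sum>(i, j)\<in>off_diagonal n. col_mean (X i \<omega>) - kernel_mean)"
    by (rule sum_off_diagonal_swap)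
  finally show ?thesis
    by (simp add: sum_off_diagonal_fst card_off_diagonal projection_def[abs_def] sum.distrib
        sum_subtractf algebra_simps)
qed

lemma u_statistic_clt:
  assumes "0 < \<sigma>" and var: "(\<integral>x. (projection x)\<^sup>2 \<partial>D) = \<sigma>\<^sup>2"
  shows "weak_conv_m (\<lambda>n. distr M borel (\<lambda>\<omega>. sqrt (real n) * (u_statistic n \<omega> - kernel_mean)))
    (density lborel (normal_density 0 \<sigma>))"
proof -
  define Z where "Z i \<omega> = projection (X i \<omega>)" for i \<omega>
  define Y where "Y n \<omega> = (\<Sum>i<n. Z i \<omega>) / sqrt (real n)" for n \<omega>
  \<comment> \<open>\<open>R n\<close> is the whole difference rather than the normalised degenerate
    sum, so that the target equals \<open>Y n + R n\<close> for every \<open>n\<close>; for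
    \<open>n\<close> at least 2 the two descriptions agree.\<close>
  define R where "R n \<omega> = sqrt (real n) * (u_statistic n \<omega> - kernel_mean) - Y n \<omega>" for n \<omega>
  have pm [measurable]: "projection \<in> borel_measurable N"
    unfolding projection_def[abs_def] by measurable
  have Zm [measurable]: "random_variable borel (Z i)" for i
    unfolding Z_def[abs_def] by measurable
  have Ym [measurable]: "random_variable borel (Y i)" for i
    unfolding Y_def[abs_def] by measurable
  have um [measurable]: "random_variable borel (u_statistic n)" for n
    unfolding u_statistic_def[abs_def] case_prod_beta by measurable
  have Rm [measurable]: "random_variable borel (R n)" for n
    unfolding R_def[abs_def] by measurable
  have pb: "\<bar>projection x\<bar> \<le> 4" for x
    using row_mean_bound[of x] col_mean_bound[of x] kernel_mean_bound
    unfolding projection_def by linarith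
  have Zb: "\<bar>Z i \<omega>\<bar> \<le> 4" for i \<omega> by (simp add: Z_def pb)
  have wc: "weak_conv_m (\<lambda>n. distr M borel (Y n)) (density lborel (normal_density 0 \<sigma>))"
    unfolding Y_def
  proof (rule central_limit_theorem_centered[where D = "distr D borel projection"])
    show "indep_vars (\<lambda>_. borel) Z UNIV"
      unfolding Z_def[abs_def] by (rule indep_vars_compose2[OF indep]) measurable
    show "expectation (Z n) = 0" for n
    proof -
      have "expectation (Z n) = (\<integral>x. projection x \<partial>D)"
        using integral_distr[OF X_measurable[of n] pm] by (simp add: distr_X Z_def[abs_def])
      also have "\<dots> = 0"
        unfolding projection_def using integrable_row_mean integrable_col_mean
        by (simp add: integral_col_mean kernel_mean_def[symmetric] D_prob_space_N)
      finally show ?thesis .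
    qed
    have b: "(Z n \<omega>)\<^sup>2 \<le> 16" for n \<omega>
      using power_mono[OF Zb[of n \<omega>], of 2] by simp
    show "integrable M (\<lambda>\<omega>. (Z n \<omega>)\<^sup>2)" for n
      by (rule integrable_const_bound[of _ 16]) (auto simp: b)
    show "expectation (\<lambda>\<omega>. (Z n \<omega>)\<^sup>2) = \<sigma>\<^sup>2" for n
      unfolding var[symmetric]
      using integral_distr[OF X_measurable[of n], of "\<lambda>x. (projection x)\<^sup>2"]
      by (simp add: distr_X Z_def[abs_def])
    show "distr M borel (Z n) = distr D borel projection" for n
      using distr_distr[OF pm X_measurable[of n]]
      by (simp add: distr_X Z_def[abs_def] comp_def)
  qed fact
  \<comment> \<open>A crude bound depending on \<open>n\<close>; it serves the integrability of
    \<open>R n\<close> and of its square.\<close>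
  have ub: "\<bar>u_statistic n \<omega>\<bar> \<le> \<bar>1 / (real n * (real n - 1))\<bar> * real (n * (n - 1))" for n \<omega>
  proof -
    have "\<bar>\<Sum>(i, j)\<in>off_diagonal n. k (X i \<omega>) (X j \<omega>)\<bar> \<le> (\<Sum>(i, j)\<in>off_diagonal n. 1)"
      by (rule order_trans[OF sum_abs], rule sum_mono) (auto simp: k_bound)
    then have "\<bar>\<Sum>(i, j)\<in>off_diagonal n. k (X i \<omega>) (X j \<omega>)\<bar> \<le> real (n * (n - 1))"
      by (simp add: card_off_diagonal case_prod_beta)
    from mult_left_mono[OF this, of "\<bar>1 / (real n * (real n - 1))\<bar>"] show ?thesis
      by (simp add: u_statistic_def abs_mult)
  qed
  have Yb: "\<bar>Y n \<omega>\<bar> \<le> (\<Sum>i<n. 4) / sqrt (real n)" for n \<omega>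
    unfolding Y_def abs_divide
    by (simp only: abs_of_nonneg real_sqrt_ge_zero of_nat_0_le_iff, rule divide_right_mono,
        rule order_trans[OF sum_abs], rule sum_mono) (auto simp: Zb)
  have Rint2: "integrable M (\<lambda>\<omega>. (R n \<omega>)\<^sup>2)" and Rint: "integrable M (R n)" for n
  proof -
    have "\<exists>B. \<forall>\<omega>. \<bar>R n \<omega>\<bar> \<le> B"
    proof (intro exI allI)
      fix \<omega>
      have "\<bar>R n \<omega>\<bar> \<le> \<bar>sqrt (real n) * (u_statistic n \<omega> - kernel_mean)\<bar> + \<bar>Y n \<omega>\<bar>"
        unfolding R_def by (rule abs_triangle_ineq4)
      also have "\<dots> \<le> sqrt (real n) * (\<bar>1 / (real n * (real n - 1))\<bar> * real (n * (n - 1)) + 1)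
          + (\<Sum>i<n. 4) / sqrt (real n)"
      proof (rule add_mono[OF _ Yb])
        have "\<bar>u_statistic n \<omega> - kernel_mean\<bar>
            \<le> \<bar>1 / (real n * (real n - 1))\<bar> * real (n * (n - 1)) + 1"
          using ub[of n \<omega>] kernel_mean_bound by linarith
        then show "\<bar>sqrt (real n) * (u_statistic n \<omega> - kernel_mean)\<bar>
            \<le> sqrt (real n) * (\<bar>1 / (real n * (real n - 1))\<bar> * real (n * (n - 1)) + 1)"
          unfolding abs_mult by (simp only: abs_of_nonneg real_sqrt_ge_zero of_nat_0_le_iff mult_left_mono)
      qed
      finally show "\<bar>R n \<omega>\<bar> \<le> sqrt (real n) * (\<bar>1 / (real n * (real n - 1))\<bar> * real (n * (n - 1)) + 1)
          + (\<Sum>i<n. 4) / sqrt (real n)" .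
    qed
    then obtain B where B: "\<And>\<omega>. \<bar>R n \<omega>\<bar> \<le> B" by auto
    show "integrable M (R n)"
      by (rule integrable_const_bound[of _ B]) (auto simp: B)
    have "(R n \<omega>)\<^sup>2 \<le> B\<^sup>2" for \<omega>
      using power_mono[OF B[of \<omega>], of 2] by simp
    then show "integrable M (\<lambda>\<omega>. (R n \<omega>)\<^sup>2)"
      by (intro integrable_const_bound[of _ "B\<^sup>2"]) auto
  qed
  \<comment> \<open>The projection sum cancels exactly and leaves the degenerate sum divided by
    \<open>sqrt (real n) * (real n - 1)\<close>; its second moment of order n^2 becomes
    \<open>32 / (real n - 1)\<close>.\<close>
  have Rsq: "expectation (\<lambda>\<omega>. (R n \<omega>)\<^sup>2) \<le> 32 / (real n - 1)" if "2 \<le> n" for n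
  proof -
    let ?S = "\<lambda>\<omega>. \<Sum>(i, j)\<in>off_diagonal n. degenerate_part (X i \<omega>) (X j \<omega>)"
    have n: "real (n - 1) = real n - 1" "0 < real n" "0 < real n - 1"
      using that by (auto simp: of_nat_diff)
    have "R n \<omega> = sqrt (real n) / (real n * (real n - 1)) * ?S \<omega>" for \<omega>
    proof -
      have "u_statistic n \<omega> - kernel_mean
          = ?S \<omega> / (real n * (real n - 1)) + (\<Sum>i<n. Z i \<omega>) / real n"
        unfolding u_statistic_def hoeffding_decomposition Z_def of_nat_mult n(1)
        using n by (simp add: field_simps)
      moreover have "sqrt (real n) * ((\<Sum>i<n. Z i \<omega>) / real n) = Y n \<omega>"
        unfolding Y_def using n(2) by (simp add: real_div_sqrt divide_simps)
      ultimately show ?thesis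
        unfolding R_def by (simp add: distrib_left)
    qed
    then have "expectation (\<lambda>\<omega>. (R n \<omega>)\<^sup>2)
        = real n / (real n * (real n - 1))\<^sup>2 * expectation (\<lambda>\<omega>. (?S \<omega>)\<^sup>2)"
      by (simp add: power_mult_distrib power_divide)
    also have "\<dots> \<le> real n / (real n * (real n - 1))\<^sup>2 * (32 * real (n * (n - 1)))"
      by (intro mult_left_mono degenerate_sum_second_moment) simp
    also have "\<dots> = 32 / (real n - 1)"
    proof -
      have "a / (a * b)\<^sup>2 * (32 * (a * b)) = 32 / b" if "0 < a" "0 < b" for a b :: real
        using that by (simp add: field_simps power2_eq_square)
      from this[OF n(2,3)] show ?thesis
        by (simp only: of_nat_mult n(1))
    qed
    finally show ?thesis .
  qed
  have null: "(\<lambda>n. expectation (\<lambda>\<omega>. \<bar>R n \<omega>\<bar>)) \<longlonglongrightarrow> 0"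
  proof (rule tendsto_sandwich[where f = "\<lambda>_. 0" and h = "\<lambda>n. sqrt (32 / (real n - 1))"])
    show "(\<lambda>n. sqrt (32 / (real n - 1))) \<longlonglongrightarrow> 0"
      by real_asymp
    show "\<forall>\<^sub>F n in sequentially. expectation (\<lambda>\<omega>. \<bar>R n \<omega>\<bar>) \<le> sqrt (32 / (real n - 1))"
      using eventually_ge_at_top[of 2]
    proof eventually_elim
      case (elim n)
      have "expectation (\<lambda>\<omega>. \<bar>R n \<omega>\<bar>) \<le> sqrt (expectation (\<lambda>\<omega>. (R n \<omega>)\<^sup>2))"
        by (rule expectation_abs_le_sqrt_expectation_square[OF Rm Rint2])
      also have "\<dots> \<le> sqrt (32 / (real n - 1))"
        using Rsq[OF elim] by simp
      finally show ?case .
    qed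
  qed auto
  have "real_distribution (density lborel (normal_density 0 \<sigma>))"
    using prob_space_normal_density[OF \<open>0 < \<sigma>\<close>, of 0]
    by (auto simp: real_distribution_def real_distribution_axioms_def)
  from weak_conv_m_add_null[OF Ym Rint wc this null] show ?thesis
    by (simp add: R_def)
qed

end

section \<open>The uniform distribution on the unit interval\<close>

abbreviation unit_uniform :: "real measure" where
  "unit_uniform \<equiv> uniform_measure lborel {0<..<1}"

lemma prob_space_unit_uniform: "prob_space unit_uniform"
  by (rule prob_space_uniform_measure) auto

text \<open>Passing to the gauge integral on the closed interval makes it possible to glue pieces
  with \<open>has_integral_combine\<close>; the added endpoints form a null set.\<close>

lemma integral_unit_uniform:
  fixes f :: "real \<Rightarrow> real"
  assumes [measurable]: "f \<in> borel_measurable borel"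
    and bound: "\<And>x. \<bar>f x\<bar> \<le> B"
    and I: "(f has_integral I) {0..1}"
  shows "(\<integral>x. f x \<partial>unit_uniform) = I"
proof -
  have "(\<integral>x. f x \<partial>unit_uniform) = (\<integral>x. indicator {0<..<1} x * f x \<partial>lborel)"
  proof -
    have "unit_uniform = density lborel (\<lambda>x. ennreal (indicator {0<..<1} x))"
      by (simp add: uniform_measure_def ennreal_indicator divide_ennreal_def)
    then show ?thesis by (simp add: integral_density)
  qed
  also have "\<dots> = (\<integral>x. indicator {0..1} x * f x \<partial>lborel)"
  proof (rule integral_cong_AE)
    have "AE x in lborel. x \<noteq> (0::real) \<and> x \<noteq> 1"
      using AE_lborel_singleton[of "0::real"] AE_lborel_singleton[of "1::real"]
      by eventually_elim auto
    then show "AE x in lborel. indicator {0<..<1} x * f x = indicator {0..1} x * f x"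
      by eventually_elim (auto simp: indicator_def)
  qed auto
  also have "\<dots> = (LINT x:{0..1}|lborel. f x)"
    by (simp add: set_lebesgue_integral_def)
  also have "\<dots> = integral {0..1} f"
  proof (rule set_borel_integral_eq_integral(2))
    show "set_integrable lborel {0..1} f"
      unfolding set_integrable_def
    proof (rule Bochner_Integration.integrable_bound)
      show "integrable lborel (\<lambda>x::real. indicator {0..1} x * B)"
by (intro integrable_mult_left integrable_real_indicator) auto
      show "AE x in lborel. norm (indicat_real {0..1} x *\<^sub>R f x) \<le> norm (indicator {0..1} x * B)"
        by (rule AE_I2) (use bound abs_ge_self[of B] in \<open>auto simp: indicator_def intro: order_trans\<close>)
    qed auto
  qed
  also have "\<dots> = I" using I by (rule integral_unique)
  finally show ?thesis .
qed

text \<open>The exceptional point \<open>a\<close> serves as the centre when integrating over the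
  base point of a region: the descriptions left and right of the centre say nothing there.\<close>

lemma integral_unit_uniform_interval:
  assumes P [measurable]: "Measurable.pred borel P"
    and eq: "\<And>y. 0 < y \<Longrightarrow> y < 1 \<Longrightarrow> y \<noteq> a \<Longrightarrow> P y \<longleftrightarrow> l < y \<and> y < h"
    and ord: "0 \<le> l" "l \<le> h" "h \<le> 1"
  shows "(\<integral>y. of_bool (P y) \<partial>unit_uniform) = (h - l :: real)"
proof -
  interpret prob_space unit_uniform by (rule prob_space_unit_uniform)
  have "AE y in lborel. y \<in> {0<..<1} \<longrightarrow> (P y \<longleftrightarrow> l < y \<and> y < h)"
    using AE_lborel_singleton[of a] by eventually_elim (use eq in auto)
  then have "AE y in unit_uniform. P y \<longleftrightarrow> l < y \<and> y < h"
    by (subst AE_uniform_measure) auto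
  then have "(\<integral>y. of_bool (P y) \<partial>unit_uniform) = (\<integral>y. indicator {l<..<h} y \<partial>unit_uniform :: real)"
    by (intro integral_cong_AE) (auto simp: indicator_def elim: eventually_mono)
  also have "\<dots> = measure unit_uniform {l<..<h}"
    by simp
  also have "\<dots> = measure lborel {l<..<h}"
    using ord by (subst measure_uniform_measure) (auto simp: Int_absorb1 greaterThanLessThan_subseteq_greaterThanLessThan)
  also have "\<dots> = h - l"
    using ord by simp
  finally show ?thesis .
qed

section \<open>Exact integrals of affine pieces\<close>

lemma has_integral_affine:
  fixes f :: "real \<Rightarrow> real"
  assumes "a \<le> b" and f: "\<And>x. a < x \<Longrightarrow> x < b \<Longrightarrow> f x = p + q * x"
  shows "(f has_integral (b - a) * ((p + q * a) + (p + q * b)) / 2) {a..b}"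
proof (rule has_integral_spike_interior[of "\<lambda>x. p + q * x" _ a b f, simplified cbox_interval])
  have "((\<lambda>x. p + q * x) has_integral
      (p * b + q * b\<^sup>2 / 2) - (p * a + q * a\<^sup>2 / 2)) {a..b}"
    by (rule fundamental_theorem_of_calculus[OF \<open>a \<le> b\<close>])
       (auto intro!: derivative_eq_intros simp: has_real_derivative_iff_has_vector_derivative[symmetric])
  also have "(p * b + q * b\<^sup>2 / 2) - (p * a + q * a\<^sup>2 / 2) = (b - a) * ((p + q * a) + (p + q * b)) / 2"
    by (simp add: field_simps power2_eq_square)
  finally show "((\<lambda>x. p + q * x) has_integral (b - a) * ((p + q * a) + (p + q * b)) / 2) {a..b}" .
qed (use f in auto)

text \<open>The mean of the square of an affine function with end values A and B is (A^2 + A B +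
  B^2) / 3. Since \<open>f\<close> is prescribed only inside the interval, no value at a breakpoint
  has to be computed.\<close>

lemma has_integral_affine_square:
  fixes f :: "real \<Rightarrow> real"
  assumes "a \<le> b" and f: "\<And>x. a < x \<Longrightarrow> x < b \<Longrightarrow> f x = p + q * x"
  shows "((\<lambda>x. (f x)\<^sup>2) has_integral
    (b - a) * ((p + q * a)\<^sup>2 + (p + q * a) * (p + q * b) + (p + q * b)\<^sup>2) / 3) {a..b}"
proof (rule has_integral_spike_interior[of "\<lambda>x. (p + q * x)\<^sup>2" _ a b "\<lambda>x. (f x)\<^sup>2", simplified cbox_interval])
  have "((\<lambda>x. (p + q * x)\<^sup>2) has_integral
      (p\<^sup>2 * b + p * q * b\<^sup>2 + q\<^sup>2 * b ^ 3 / 3) - (p\<^sup>2 * a + p * q * a\<^sup>2 + q\<^sup>2 * a ^ 3 / 3)) {a..b}"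
    by (rule fundamental_theorem_of_calculus[OF \<open>a \<le> b\<close>])
       (auto intro!: derivative_eq_intros simp: has_real_derivative_iff_has_vector_derivative[symmetric]
          power2_eq_square algebra_simps)
  also have "(p\<^sup>2 * b + p * q * b\<^sup>2 + q\<^sup>2 * b ^ 3 / 3) - (p\<^sup>2 * a + p * q * a\<^sup>2 + q\<^sup>2 * a ^ 3 / 3)
      = (b - a) * ((p + q * a)\<^sup>2 + (p + q * a) * (p + q * b) + (p + q * b)\<^sup>2) / 3"
    by (simp add: field_simps power2_eq_square power3_eq_cube)
  finally show "((\<lambda>x. (p + q * x)\<^sup>2) has_integral
    (b - a) * ((p + q * a)\<^sup>2 + (p + q * a) * (p + q * b) + (p + q * b)\<^sup>2) / 3) {a..b}" .
qed (use f in auto)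

text \<open>A vanishing integral would force \<open>f\<close> to be 0 almost everywhere, but on
  \<open>{a<..<b}\<close> the non-constant affine function can vanish only at
  \<open>- p / q\<close>.\<close>

lemma integral_unit_uniform_square_pos:
  fixes f :: "real \<Rightarrow> real"
  assumes [measurable]: "f \<in> borel_measurable borel"
    and bound: "\<And>x. \<bar>f x\<bar> \<le> B"
    and ab: "0 \<le> a" "a < b" "b \<le> 1"
    and f: "\<And>x. a < x \<Longrightarrow> x < b \<Longrightarrow> f x = p + q * x"
    and "q \<noteq> 0"
  shows "0 < (\<integral>x. (f x)\<^sup>2 \<partial>unit_uniform)"
proof -
  interpret prob_space unit_uniform by (rule prob_space_unit_uniform)
  have b2: "(f x)\<^sup>2 \<le> B\<^sup>2" for x
    using power_mono[OF bound[of x], of 2] by simp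
  have int: "integrable unit_uniform (\<lambda>x. (f x)\<^sup>2)"
    by (rule integrable_const_bound[of _ "B\<^sup>2"]) (auto simp: b2)
  have "(\<integral>x. (f x)\<^sup>2 \<partial>unit_uniform) \<noteq> 0"
  proof
    assume "(\<integral>x. (f x)\<^sup>2 \<partial>unit_uniform) = 0"
    then have "AE x in unit_uniform. (f x)\<^sup>2 = 0"
      by (subst (asm) integral_nonneg_eq_0_iff_AE[OF int]) auto
    then have "AE x in lborel. x \<in> {0<..<1} \<longrightarrow> (f x)\<^sup>2 = 0"
      by (subst (asm) AE_uniform_measure) auto
    then have "AE x in lborel. x \<notin> {a<..<b}"
      using AE_lborel_singleton[of "- p / q"]
    proof eventually_elim
      case (elim x)
      show ?case
      proof
        assume x: "x \<in> {a<..<b}"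
        then have "p + q * x = 0" using elim(1) f[of x] ab by auto
        then have "x = - p / q" using \<open>q \<noteq> 0\<close> by (simp add: field_simps)
        with elim(2) show False by simp
      qed
    qed
    then have "emeasure lborel {a<..<b} = 0"
      by (subst (asm) AE_iff_measurable[of "{a<..<b}"]) auto
    with ab show False by simp
  qed
  moreover have "0 \<le> (\<integral>x. (f x)\<^sup>2 \<partial>unit_uniform)"
    by (rule Bochner_Integration.integral_nonneg) simp
  ultimately show ?thesis by linarith
qed

section \<open>Proximity regions on the unit interval\<close>

lemma cs_region_measurable [measurable]:
  "Measurable.pred (borel \<Otimes>\<^sub>M borel) (\<lambda>(x, y). y \<in> cs_region b y1 y2 \<tau> c x)"
proof -
  have "y \<in> cs_region b y1 y2 \<tau> c x \<longleftrightarrow> y1 < y \<and> y < y2 \<and>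
    (if y1 < x \<and> (x < y1 + c * (y2 - y1) \<or> x = y1 + c * (y2 - y1) \<and> b)
     then x - \<tau> * (x - y1) < y \<and> y < x + \<tau> * (1 - c) * (x - y1) / c
     else x < y2 \<and> (y1 + c * (y2 - y1) < x \<or> x = y1 + c * (y2 - y1) \<and> \<not> b) \<and>
       x - c * \<tau> * (y2 - x) / (1 - c) < y \<and> y < x + \<tau> * (y2 - x))" for x y
    by (auto simp: cs_region_def Let_def)
  then show ?thesis
    by (simp only: case_prod_beta) measurable
qed

lemma cs_region_rescale:
  assumes "y1 < y2"
  shows "y \<in> cs_region b y1 y2 \<tau> c x \<longleftrightarrow>
    (y - y1) / (y2 - y1) \<in> cs_region b 0 1 \<tau> c ((x - y1) / (y2 - y1))"
proof -
  define w x' y' where "w = y2 - y1" and "x' = (x - y1) / w" and "y' = (y - y1) / w"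
  have w: "0 < w" using assms by (simp add: w_def)
  have y2: "y2 = y1 + w" by (simp add: w_def)
  have x: "x = y1 + w * x'" and y: "y = y1 + w * y'"
    using w by (simp_all add: x'_def y'_def)
  have lt: "y1 + w * s < y1 + w * t \<longleftrightarrow> s < t" for s t using w by simp
  have eq: "y1 + w * s = y1 + w * t \<longleftrightarrow> s = t" for s t using w by simp
  have ends: "y1 < y1 + w * s \<longleftrightarrow> 0 < s" "y1 + w * s < y1 + w \<longleftrightarrow> s < 1" for s
    using lt[of 0 s] lt[of s 1] by simp_all
  \<comment> \<open>Each bound is brought into the form \<open>y1 + w * s\<close>; then
    \<open>lt\<close>, \<open>eq\<close> and \<open>ends\<close> cancel the affine map from every
    comparison.\<close>
  have 1: "y1 + w * x' - \<tau> * (y1 + w * x' - y1) = y1 + w * (x' - \<tau> * (x' - 0))"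
    by (simp add: algebra_simps)
  have 2: "y1 + w * x' + \<tau> * (1 - c) * (y1 + w * x' - y1) / c = y1 + w * (x' + \<tau> * (1 - c) * (x' - 0) / c)"
    by (simp add: algebra_simps diff_divide_distrib)
  have 3: "y1 + w * x' - c * \<tau> * (y1 + w - (y1 + w * x')) / (1 - c)
      = y1 + w * (x' - c * \<tau> * (1 - x') / (1 - c))"
    by (simp add: algebra_simps diff_divide_distrib)
  have 4: "y1 + w * x' + \<tau> * (y1 + w - (y1 + w * x')) = y1 + w * (x' + \<tau> * (1 - x'))"
    by (simp add: algebra_simps)
  have 5: "y1 + c * (y1 + w - y1) = y1 + w * c"
    by (simp add: algebra_simps)
  have "y \<in> cs_region b y1 y2 \<tau> c x \<longleftrightarrow> y' \<in> cs_region b 0 1 \<tau> c x'"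
    unfolding x y y2 cs_region_def Let_def 1 2 3 4 5 lt eq ends
    by (auto simp only: lt eq ends greaterThanLessThan_iff Int_iff empty_iff split: if_splits) auto
  then show ?thesis by (simp add: x'_def y'_def w_def)
qed

section \<open>Conditional means of the arc indicator\<close>

locale cs_parameters =
  fixes left_at_centre :: bool and \<tau> c :: real
  assumes c_pos: "0 < c" and c_less_1: "c < 1" and \<tau>_pos: "0 < \<tau>"
begin

definition kernel :: "real \<Rightarrow> real \<Rightarrow> real" where
  "kernel x y = of_bool (y \<in> cs_region left_at_centre 0 1 \<tau> c x)"

definition u :: real where "u = c + \<tau> * (1 - c)"
definition v :: real where "v = 1 - c + \<tau> * c"

definition row :: "real \<Rightarrow> real" where "row x = (\<integral>y. kernel x y \<partial>unit_uniform)"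
definition col :: "real \<Rightarrow> real" where "col y = (\<integral>x. kernel x y \<partial>unit_uniform)"

lemma u_gt: "c < u" using c_less_1 \<tau>_pos by (simp add: u_def)
lemma v_gt: "1 - c < v" using c_pos \<tau>_pos by (simp add: v_def)
lemma u_pos: "0 < u" using u_gt c_pos by simp
lemma v_pos: "0 < v" using v_gt c_less_1 by simp

lemma kernel_measurable [measurable]: "case_prod kernel \<in> borel_measurable (borel \<Otimes>\<^sub>M borel)"
proof -
  have "(\<lambda>z. of_bool ((\<lambda>(x, y). y \<in> cs_region left_at_centre 0 1 \<tau> c x) z) :: real)
      \<in> borel_measurable (borel \<Otimes>\<^sub>M borel)"
    by measurable
  then show ?thesis by (simp add: kernel_def[abs_def] case_prod_beta)
qed

text \<open>Both ends are linear in \<open>x\<close> and vanish at 0; at the centre they would reach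
  \<open>c * (1 - \<tau>) = 1 - v\<close> and \<open>u\<close>. Right of the centre the same holds
  for distances to 1, with \<open>v\<close> in place of \<open>u\<close>.\<close>

lemma region_left:
  assumes "0 < x" "x < c" "0 < y" "y < 1"
  shows "y \<in> cs_region left_at_centre 0 1 \<tau> c x \<longleftrightarrow> x * (1 - \<tau>) < y \<and> y < x * u / c"
proof -
  have "x + \<tau> * (1 - c) * x / c = x * u / c"
    using c_pos by (simp add: u_def field_simps)
  then show ?thesis using assms by (auto simp: cs_region_def algebra_simps)
qed

lemma region_right:
  assumes "c < x" "x < 1" "0 < y" "y < 1"
  shows "y \<in> cs_region left_at_centre 0 1 \<tau> c x \<longleftrightarrow>
    1 - (1 - x) * v / (1 - c) < y \<and> y < 1 - (1 - x) * (1 - \<tau>)"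
proof -
  have "x - c * \<tau> * (1 - x) / (1 - c) = 1 - (1 - x) * v / (1 - c)"
    using c_less_1 by (simp add: v_def field_simps)
  then show ?thesis using assms by (auto simp: cs_region_def algebra_simps)
qed

lemma region_section_measurable [measurable]:
  "Measurable.pred borel (\<lambda>y. y \<in> cs_region left_at_centre 0 1 \<tau> c x)"
  "Measurable.pred borel (\<lambda>x. y \<in> cs_region left_at_centre 0 1 \<tau> c x)"
proof -
  have "Measurable.pred borel (\<lambda>y. (\<lambda>(x, y). y \<in> cs_region left_at_centre 0 1 \<tau> c x) (x, y))"
    "Measurable.pred borel (\<lambda>x. (\<lambda>(x, y). y \<in> cs_region left_at_centre 0 1 \<tau> c x) (x, y))"
    by measurable
  then show "Measurable.pred borel (\<lambda>y. y \<in> cs_region left_at_centre 0 1 \<tau> c x)"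
    "Measurable.pred borel (\<lambda>x. y \<in> cs_region left_at_centre 0 1 \<tau> c x)" by simp_all
qed

lemma row_eqI:
  assumes "\<And>y. 0 < y \<Longrightarrow> y < 1 \<Longrightarrow> y \<in> cs_region left_at_centre 0 1 \<tau> c x \<longleftrightarrow> l < y \<and> y < h"
    and "0 \<le> l" "l \<le> h" "h \<le> 1"
  shows "row x = h - l"
  unfolding row_def kernel_def
  by (rule integral_unit_uniform_interval[where a = 0]) (use assms in auto)

lemma col_eqI:
  assumes "\<And>z. 0 < z \<Longrightarrow> z < 1 \<Longrightarrow> z \<noteq> c \<Longrightarrow>
      x \<in> cs_region left_at_centre 0 1 \<tau> c z \<longleftrightarrow> l < z \<and> z < h"
    and "0 \<le> l" "l \<le> h" "h \<le> 1"
  shows "col x = h - l"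
  unfolding col_def kernel_def
  by (rule integral_unit_uniform_interval[where a = c]) (use assms in auto)

text \<open>For \<tau> < 1 also \<open>u < 1\<close>, so no truncation occurs; the length is
  proportional to \<open>x\<close> and tends to \<open>u - c * (1 - \<tau>) = \<tau>\<close> at the
  centre.\<close>

lemma row_small_left:
  assumes "\<tau> < 1" "0 < x" "x < c"
  shows "row x = \<tau> / c * x"
proof -
  have "\<tau> * (1 - c) < 1 * (1 - c)" using assms c_less_1 by (intro mult_strict_right_mono) auto
  then have "u < 1" by (simp add: u_def algebra_simps)
  then have le: "x * u / c \<le> 1"
    using mult_mono[of x c u 1] assms u_pos c_pos by simp
  have "row x = x * u / c - x * (1 - \<tau>)"
  proof (rule row_eqI)
    show "x * (1 - \<tau>) \<le> x * u / c"
      using assms u_gt c_pos \<tau>_pos by (simp add: field_simps u_def)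
  qed (use region_left assms c_less_1 le in auto)
  also have "\<dots> = \<tau> / c * x"
    using c_pos by (simp add: u_def field_simps)
  finally show ?thesis .
qed

lemma row_small_right:
  assumes "\<tau> < 1" "c < x" "x < 1"
  shows "row x = \<tau> / (1 - c) * (1 - x)"
proof -
  have "\<tau> * c < 1 * c" using assms c_pos by (intro mult_strict_right_mono) auto
  then have "v < 1" by (simp add: v_def algebra_simps)
  then have le: "(1 - x) * v / (1 - c) \<le> 1"
    using mult_mono[of "1 - x" "1 - c" v 1] assms v_pos c_less_1 by simp
  have "row x = (1 - (1 - x) * (1 - \<tau>)) - (1 - (1 - x) * v / (1 - c))"
  proof (rule row_eqI)
    have "(1 - x) * (1 - \<tau>) \<le> (1 - x) * (v / (1 - c))"
      using assms v_gt c_less_1 \<tau>_pos by (intro mult_left_mono) (auto simp: le_divide_eq v_def algebra_simps)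
    then show "1 - (1 - x) * v / (1 - c) \<le> 1 - (1 - x) * (1 - \<tau>)" by simp
  qed (use region_right assms c_pos le in auto)
  also have "\<dots> = \<tau> / (1 - c) * (1 - x)"
    using c_less_1 by (simp add: v_def field_simps)
  finally show ?thesis .
qed

text \<open>Solved for the base point \<open>z\<close>. The inequality with the factor
  \<open>1 - \<tau>\<close> stays undivided because the sign of that factor depends on
  \<tau>.\<close>

lemma region_converse_left:
  assumes "0 < z" "z < c" "0 < x" "x < 1"
  shows "x \<in> cs_region left_at_centre 0 1 \<tau> c z \<longleftrightarrow> z * (1 - \<tau>) < x \<and> c / u * x < z"
  using region_left[OF assms] u_pos c_pos by (simp add: field_simps)

lemma region_converse_right:
  assumes "c < z" "z < 1" "0 < x" "x < 1"
  shows "x \<in> cs_region left_at_centre 0 1 \<tau> c z \<longleftrightarrow>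
    z < 1 - (1 - c) / v * (1 - x) \<and> (1 - z) * (1 - \<tau>) < 1 - x"
  using region_right[OF assms] v_pos c_less_1 by (auto simp: field_simps)

lemma c_over_u: "0 < c / u" "c / u < 1"
  using u_gt c_pos u_pos by simp_all

lemma c_over_v: "0 < (1 - c) / v" "(1 - c) / v < 1"
  using v_gt c_less_1 v_pos by simp_all

text \<open>Since \<open>c * (1 - \<tau>) = 1 - v\<close>, the point \<open>x\<close> lies left of
  the region of the centre. Only base points left of the centre reach it, and both ends of their
  interval come from the left branch.\<close>

lemma col_small_left:
  assumes "\<tau> < 1" "0 < x" "x < c * (1 - \<tau>)"
  shows "col x = (1 / (1 - \<tau>) - c / u) * x"
proof -
  have xc: "x / (1 - \<tau>) < c" using assms by (simp add: field_simps)
  have "c * (1 - \<tau>) \<le> 1 * (1 - \<tau>)" using assms c_less_1 by (intro mult_right_mono) auto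
  with assms(3) have "x < 1 * (1 - \<tau>)" by (rule order_less_le_trans)
  then have x1: "x < 1 - \<tau>" by simp
  have "x < c" using assms c_pos \<tau>_pos by (smt (verit) mult_less_cancel_left2)
  have "col x = x / (1 - \<tau>) - c / u * x"
  proof (rule col_eqI)
    fix z :: real assume z: "0 < z" "z < 1" "z \<noteq> c"
    show "x \<in> cs_region left_at_centre 0 1 \<tau> c z \<longleftrightarrow> c / u * x < z \<and> z < x / (1 - \<tau>)"
    proof (cases "z < c")
      case True
      then show ?thesis
        using region_converse_left[of z x] z assms \<open>x < c\<close> c_less_1
        by (auto simp: field_simps)
    next
      case False
      then have "c < z" using z by simp
      \<comment> \<open>No region based right of the centre extends down to \<open>x\<close>,
        because \<open>1 - x\<close> exceeds \<open>v\<close>.\<close>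
      have "1 - (1 - c) / v * (1 - x) < c"
      proof -
        have "v < 1 - x" using assms by (simp add: v_def algebra_simps)
        then have "(1 - c) * v < (1 - c) * (1 - x)" using c_less_1 by simp
        then show ?thesis using v_pos by (simp add: field_simps)
      qed
      then show ?thesis
        using region_converse_right[of z x] z \<open>c < z\<close> \<open>x < c\<close> assms xc c_less_1 by auto
    qed
  next
    show "c / u * x \<le> x / (1 - \<tau>)"
    proof -
      have "c / u * x \<le> 1 * x" using c_over_u assms by (intro mult_right_mono) auto
      also have "\<dots> \<le> x / (1 - \<tau>)" using assms \<tau>_pos by (simp add: field_simps)
      finally show ?thesis .
    qed
  qed (use x1 u_pos c_pos assms in auto)
  then show ?thesis by (simp add: algebra_simps)
qed

text \<open>\<open>x\<close> lies in the region of the centre, so the interval of base points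
  surrounds \<open>c\<close>: its lower end comes from the left branch, its upper end from the right
  one. The first two assumptions are conditional because for \<tau> \<ge> 1 the region of the centre
  is all of (0,1).\<close>

lemma col_middle:
  assumes "\<tau> < 1 \<Longrightarrow> c * (1 - \<tau>) < x" "\<tau> < 1 \<Longrightarrow> x < u" "0 < x" "x < 1"
  shows "col x = 1 - c / u * x - (1 - c) / v * (1 - x)"
proof -
  have xu: "x \<le> u" 
  proof (cases "\<tau> < 1")
    case False
    then have "1 * (1 - c) \<le> \<tau> * (1 - c)" using c_less_1 by (intro mult_right_mono) auto
    then have "1 \<le> u" by (simp add: u_def)
    then show ?thesis using assms by simp
  qed (use assms in auto)
  have xv: "1 - x \<le> v"
  proof (cases "\<tau> < 1")
    case False
    then have "1 * c \<le> \<tau> * c" using c_pos by (intro mult_right_mono) auto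
    then have "1 \<le> v" by (simp add: v_def)
    then show ?thesis using assms by simp
  qed (use assms in \<open>auto simp: v_def algebra_simps\<close>)
  \<comment> \<open>Together with \<open>h\<close> this places \<open>c\<close> between the ends, so
    each end constrains \<open>z\<close> on one side of \<open>c\<close> only.\<close>
  have l: "c / u * x \<le> c" using xu u_pos c_pos by (simp add: field_simps)
  have h: "c \<le> 1 - (1 - c) / v * (1 - x)"
  proof -
    have "(1 - c) * (1 - x) \<le> (1 - c) * v" using xv c_less_1 by (intro mult_left_mono) auto
    then show ?thesis using v_pos by (simp add: field_simps)
  qed
  have "col x = (1 - (1 - c) / v * (1 - x)) - c / u * x"
  proof (rule col_eqI)
    fix z :: real assume z: "0 < z" "z < 1" "z \<noteq> c"
    show "x \<in> cs_region left_at_centre 0 1 \<tau> c z \<longleftrightarrow> c / u * x < z \<and> z < 1 - (1 - c) / v * (1 - x)"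
    proof (cases "z < c")
      case True
      \<comment> \<open>The other bound is automatic: for \<tau> < 1 the left side stays below its
        value at the centre, otherwise it is not positive.\<close>
      have "z * (1 - \<tau>) < x"
      proof (cases "\<tau> < 1")
        case t: True
        have "z * (1 - \<tau>) \<le> c * (1 - \<tau>)" using t True by (intro mult_right_mono) auto
        then show ?thesis using assms(1)[OF t] by simp
      next
        case False
        then have "z * (1 - \<tau>) \<le> 0" using z by (simp add: mult_nonneg_nonpos)
        then show ?thesis using assms by simp
      qed
      then show ?thesis
        using region_converse_left[of z x] True z assms h by auto
    next
      case False
      then have "c < z" using z by simp
      have "(1 - z) * (1 - \<tau>) < 1 - x"
      proof (cases "\<tau> < 1")
        case t: True
        have "(1 - z) * (1 - \<tau>) \<le> (1 - c) * (1 - \<tau>)" using t \<open>c < z\<close> by (intro mult_right_mono) auto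
        also have "\<dots> = 1 - u" by (simp add: u_def algebra_simps)
        finally show ?thesis using assms(2)[OF t] by simp
      next
        case False
        then have "(1 - z) * (1 - \<tau>) \<le> 0" using z by (simp add: mult_nonneg_nonpos)
        then show ?thesis using assms by simp
      qed
      then show ?thesis
        using region_converse_right[of z x] \<open>c < z\<close> z assms l by auto
    qed
  next
    show "0 \<le> c / u * x" using u_pos c_pos assms by simp
    show "1 - (1 - c) / v * (1 - x) \<le> 1" using v_pos c_less_1 assms by simp
  qed (use l h in linarith)
  then show ?thesis by simp
qed

text \<open>Mirror image of \<open>col_small_left\<close>: \<open>x\<close> lies beyond the region
  of the centre, so only base points right of the centre reach it.\<close>

lemma col_small_right:
  assumes "\<tau> < 1" "u < x" "x < 1"
  shows "col x = (1 / (1 - \<tau>) - (1 - c) / v) * (1 - x)"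
proof -
  have "1 - x < (1 - c) * (1 - \<tau>)" using assms by (simp add: u_def algebra_simps)
  then have xc: "(1 - x) / (1 - \<tau>) < 1 - c" using assms by (simp add: field_simps)
  have "(1 - c) * (1 - \<tau>) \<le> 1 * (1 - \<tau>)" using assms c_pos by (intro mult_right_mono) auto
  with \<open>1 - x < _\<close> have "1 - x < 1 * (1 - \<tau>)" by (rule order_less_le_trans)
  then have x1: "1 - x < 1 - \<tau>" by simp
  have "c < x" using assms u_gt by simp
  have xl: "c < c / u * x" using assms u_pos c_pos by (simp add: field_simps)
  have "col x = (1 - (1 - c) / v * (1 - x)) - (1 - (1 - x) / (1 - \<tau>))"
  proof (rule col_eqI)
    fix z :: real assume z: "0 < z" "z < 1" "z \<noteq> c"
    show "x \<in> cs_region left_at_centre 0 1 \<tau> c z \<longleftrightarrow>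
        1 - (1 - x) / (1 - \<tau>) < z \<and> z < 1 - (1 - c) / v * (1 - x)"
    proof (cases "z < c")
      case True
      then show ?thesis
        using region_converse_left[of z x] z assms xl xc \<open>c < x\<close> c_pos by auto
    next
      case False
      then have "c < z" using z by simp
      have "(1 - z) * (1 - \<tau>) < 1 - x \<longleftrightarrow> 1 - (1 - x) / (1 - \<tau>) < z"
        using assms by (auto simp: field_simps)
      then show ?thesis
        using region_converse_right[of z x] z \<open>c < z\<close> \<open>c < x\<close> assms c_pos by auto
    qed
  next
    have "(1 - c) / v * (1 - x) \<le> 1 * (1 - x)"
      using c_over_v assms by (intro mult_right_mono) auto
    also have "\<dots> \<le> (1 - x) / (1 - \<tau>)" using assms \<tau>_pos by (simp add: field_simps)
    finally show "1 - (1 - x) / (1 - \<tau>) \<le> 1 - (1 - c) / v * (1 - x)" by simp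
  qed (use x1 v_pos c_less_1 assms in auto)
  then show ?thesis by (simp add: algebra_simps)
qed

text \<open>The lower end is not positive, so the region reaches down to 0, while the upper end
  \<open>x * u / c\<close> stays below 1 until \<open>x = c / u\<close>.\<close>

lemma row_large_left:
  assumes "1 \<le> \<tau>" "0 < x" "x < c / u"
  shows "row x = u / c * x"
proof -
  have "1 * (1 - c) \<le> \<tau> * (1 - c)" using assms c_less_1 by (intro mult_right_mono) auto
  then have "1 \<le> u" by (simp add: u_def)
  then have "c / u \<le> c" using c_pos u_pos by (simp add: field_simps)
  then have "x < c" using assms by simp
  have "row x = x * u / c - 0"
  proof (rule row_eqI)
    fix y :: real assume "0 < y" "y < 1"
    moreover have "x * (1 - \<tau>) \<le> 0" using assms by (simp add: mult_nonneg_nonpos)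
    ultimately show "y \<in> cs_region left_at_centre 0 1 \<tau> c x \<longleftrightarrow> 0 < y \<and> y < x * u / c"
      using region_left[of x y] assms \<open>x < c\<close> by auto
  qed (use assms u_pos c_pos in \<open>auto simp: field_simps\<close>)
  then show ?thesis by simp
qed

lemma row_large_right:
  assumes "1 \<le> \<tau>" "1 - (1 - c) / v < x" "x < 1"
  shows "row x = v / (1 - c) * (1 - x)"
proof -
  have "1 * c \<le> \<tau> * c" using assms c_pos by (intro mult_right_mono) auto
  then have "1 \<le> v" by (simp add: v_def)
  then have "(1 - c) * 1 \<le> (1 - c) * v" using c_less_1 by (intro mult_left_mono) auto
  then have "(1 - c) / v \<le> 1 - c" using v_pos by (simp add: divide_le_eq)
  then have "c < x" using assms by simp
  have le: "(1 - x) * v / (1 - c) \<le> 1" using assms v_pos c_less_1 by (simp add: field_simps)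
  have "row x = 1 - (1 - (1 - x) * v / (1 - c))"
  proof (rule row_eqI)
    fix y :: real assume "0 < y" "y < 1"
    moreover have "(1 - x) * (1 - \<tau>) \<le> 0" using assms by (simp add: mult_nonneg_nonpos)
    ultimately show "y \<in> cs_region left_at_centre 0 1 \<tau> c x \<longleftrightarrow> 1 - (1 - x) * v / (1 - c) < y \<and> y < 1"
      using region_right[of x y] assms \<open>c < x\<close> by auto
  qed (use assms v_pos c_less_1 le in auto)
  then show ?thesis by simp
qed

text \<open>Truncation is active on both sides, so the region fills (0,1). The centre, described by
  neither branch, is excluded; it later becomes a breakpoint of the integration.\<close>

lemma row_large_middle:
  assumes "1 \<le> \<tau>" "c / u < x" "x < 1 - (1 - c) / v" "x \<noteq> c"
  shows "row x = 1"
proof -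
  have x: "0 < x" "x < 1" using assms c_over_u(1) c_over_v(1) by linarith+
  have "row x = 1 - 0"
  proof (rule row_eqI)
    fix y :: real assume y: "0 < y" "y < 1"
    show "y \<in> cs_region left_at_centre 0 1 \<tau> c x \<longleftrightarrow> 0 < y \<and> y < 1"
    proof (cases "x < c")
      case True
      have "x * (1 - \<tau>) \<le> 0" using assms x by (simp add: mult_nonneg_nonpos)
      moreover have "1 < x * u / c" using assms u_pos c_pos by (simp add: field_simps)
      then have "y < x * u / c" using y by linarith
      ultimately show ?thesis using region_left[of x y] True x y by auto
    next
      case False
      have "(1 - x) * (1 - \<tau>) \<le> 0" using assms x by (simp add: mult_nonneg_nonpos)
      moreover have "(1 - c) / v < 1 - x" using assms by simp
      then have "1 < (1 - x) * v / (1 - c)" using v_pos c_less_1 by (simp add: field_simps)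
      then have "1 - (1 - x) * v / (1 - c) < y" using y by linarith
      ultimately show ?thesis using region_right[of x y] False assms x y by auto
    qed
  qed auto
  then show ?thesis by simp
qed

end

section \<open>Mean and variance\<close>

text \<open>\<open>g1\<close>, \<open>g2\<close>, \<open>g3\<close> are the values of the sum of the
  conditional means at \<open>c * (1 - \<tau>)\<close>, \<open>c\<close> and \<open>u\<close>, and
  its limits at 0 and 1 are 0. The left side is its second moment over the four pieces;
  \<open>\<tau>\<^sup>2\<close> is the square of twice the mean.\<close>

lemma kappa1_identity:
  fixes \<tau> c u v :: real
  assumes u: "u = c + \<tau> * (1 - c)" and v: "v = 1 - c + \<tau> * c" and nz: "u \<noteq> 0" "v \<noteq> 0"
  defines "g1 \<equiv> \<tau> * (1 - \<tau>) + c - c / u * (c * (1 - \<tau>))"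
    and "g2 \<equiv> \<tau> + 1 - c / u * c - (1 - c) / v * (1 - c)"
    and "g3 \<equiv> \<tau> * (1 - \<tau>) + (1 - c) - (1 - c) / v * ((1 - c) * (1 - \<tau>))"
  shows "c * (1 - \<tau>) * g1\<^sup>2 / 3 + c * \<tau> * (g1\<^sup>2 + g1 * g2 + g2\<^sup>2) / 3
     + (1 - c) * \<tau> * (g2\<^sup>2 + g2 * g3 + g3\<^sup>2) / 3 + (1 - c) * (1 - \<tau>) * g3\<^sup>2 / 3
     = cs_kappa1 \<tau> c + \<tau>\<^sup>2"
proof -
  have u': "c + \<tau> - c * \<tau> = u" and v': "c * \<tau> - c + 1 = v" by (simp_all add: u v algebra_simps)
  \<comment> \<open>Numerators over \<open>u\<close>, \<open>u * v\<close> and \<open>v\<close>;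
    multiplied by \<open>3 * (u * v)\<^sup>2\<close>, the claim becomes polynomial in \<tau> and
    \<open>c\<close>.\<close>
  define G1 where "G1 = (\<tau> * (1 - \<tau>) + c) * u - c * c * (1 - \<tau>)"
  define G2 where "G2 = (\<tau> + 1) * u * v - c * c * v - (1 - c) * (1 - c) * u"
  define G3 where "G3 = (\<tau> * (1 - \<tau>) + (1 - c)) * v - (1 - c) * (1 - c) * (1 - \<tau>)"
  have g: "g1 = G1 * v / (u * v)" "g2 = G2 / (u * v)" "g3 = G3 * u / (u * v)"
    unfolding g1_def g2_def g3_def G1_def G2_def G3_def using nz by (simp_all add: field_simps)
  define P where "P = \<tau>^2 * (c^2 * \<tau>^3 - 3 * c^2 * \<tau>^2 - c * \<tau>^3 + 2 * c^2 * \<tau> + 3 * c * \<tau>^2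
           - c^2 - 2 * c * \<tau> - \<tau>^2 + c + \<tau>)"
  have "c * (1 - \<tau>) * (G1 * v)\<^sup>2 + c * \<tau> * ((G1 * v)\<^sup>2 + (G1 * v) * G2 + G2\<^sup>2)
     + (1 - c) * \<tau> * (G2\<^sup>2 + G2 * (G3 * u) + (G3 * u)\<^sup>2) + (1 - c) * (1 - \<tau>) * (G3 * u)\<^sup>2
     = P * (u * v) + 3 * \<tau>\<^sup>2 * (u * v)\<^sup>2"
    unfolding G1_def G2_def G3_def P_def u v by algebra
  moreover have "x = P * w + 3 * \<tau>\<^sup>2 * w\<^sup>2 \<Longrightarrow> w \<noteq> 0 \<Longrightarrow> x / (3 * w\<^sup>2) = P / (3 * w) + \<tau>\<^sup>2" for x w
    by (simp add: field_simps power2_eq_square)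
  ultimately have "(c * (1 - \<tau>) * (G1 * v)\<^sup>2 + c * \<tau> * ((G1 * v)\<^sup>2 + (G1 * v) * G2 + G2\<^sup>2)
     + (1 - c) * \<tau> * (G2\<^sup>2 + G2 * (G3 * u) + (G3 * u)\<^sup>2) + (1 - c) * (1 - \<tau>) * (G3 * u)\<^sup>2)
     / (3 * (u * v)\<^sup>2) = P / (3 * (u * v)) + \<tau>\<^sup>2"
    using nz by simp
  also have "P / (3 * (u * v)) = cs_kappa1 \<tau> c"
    unfolding cs_kappa1_def u' v' P_def by (simp add: mult_ac)
  finally show ?thesis
    unfolding g power_divide times_divide_times_eq power2_eq_square[symmetric]
    by (simp add: add_divide_distrib[symmetric] mult_ac) 
qed

text \<open>For \<tau> \<ge> 1 the sum has the values \<open>g1\<close> and \<open>g2\<close> at the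
  breakpoints \<open>a\<close> and \<open>1 - b\<close>, and the limits \<open>1 - b\<close> at 0
  and \<open>1 - a\<close> at 1; \<open>2 - a - b\<close> is twice the mean.\<close>

lemma kappa2_identity:
  fixes \<tau> c u v :: real
  assumes u: "u = c + \<tau> * (1 - c)" and v: "v = 1 - c + \<tau> * c" and nz: "u \<noteq> 0" "v \<noteq> 0"
  defines "a \<equiv> c / u" and "b \<equiv> (1 - c) / v"
  defines "g1 \<equiv> 2 - a * a - b * (1 - a)" and "g2 \<equiv> 2 - a * (1 - b) - b * b"
  shows "a * ((1 - b)\<^sup>2 + (1 - b) * g1 + g1\<^sup>2) / 3 + (1 - a - b) * (g1\<^sup>2 + g1 * g2 + g2\<^sup>2) / 3
     + b * (g2\<^sup>2 + g2 * (1 - a) + (1 - a)\<^sup>2) / 3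
     = cs_kappa2 \<tau> c + (2 - a - b)\<^sup>2"
proof -
  define d where "d = 1 - c"
  \<comment> \<open>The last factor in the denominator of \<open>cs_kappa2\<close> is
    \<open>- u\<close>; its cube produces the minus sign before \<open>cs_Q\<close> below.\<close>
  have u': "c * \<tau> - c - \<tau> = - u" and v': "c * \<tau> - c + 1 = v" by (simp_all add: u v algebra_simps)
  have a: "1 - a = \<tau> * d / u" and b: "1 - b = \<tau> * c / v"
    using nz by (simp_all add: a_def b_def d_def u v field_simps)
  define G1 where "G1 = 2 * u\<^sup>2 * v - c\<^sup>2 * v - \<tau> * d\<^sup>2 * u"
  define G2 where "G2 = 2 * u * v\<^sup>2 - \<tau> * c\<^sup>2 * v - d\<^sup>2 * u"
  have g1: "g1 = G1 / (u\<^sup>2 * v)"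
    unfolding g1_def a unfolding a_def b_def G1_def d_def using nz by (simp add: field_simps power2_eq_square)
  have g2: "g2 = G2 / (u * v\<^sup>2)"
    unfolding g2_def b unfolding a_def b_def G2_def d_def using nz by (simp add: field_simps power2_eq_square)
  define H1 where "H1 = \<tau>\<^sup>2 * c\<^sup>2 * u ^ 4 + \<tau> * c * G1 * u\<^sup>2 + G1\<^sup>2"
  define H2 where "H2 = G1\<^sup>2 * v\<^sup>2 + G1 * G2 * u * v + G2\<^sup>2 * u\<^sup>2"
  define H3 where "H3 = \<tau>\<^sup>2 * d\<^sup>2 * v ^ 4 + \<tau> * d * G2 * v\<^sup>2 + G2\<^sup>2"
  \<comment> \<open>The three pieces brought over \<open>u ^ 5 * v ^ 5\<close>; only their
    numerators are compared, as polynomials in \<tau> and \<open>c\<close>.\<close>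
  have "c * v ^ 3 * H1 + (u * v - c * v - d * u) * H2 + d * u ^ 3 * H3
      = 3 * u ^ 3 * v ^ 3 * (2 * u * v - c * v - d * u)\<^sup>2 - c * d * cs_Q \<tau> c * u\<^sup>2 * v\<^sup>2"
    unfolding H1_def H2_def H3_def G1_def G2_def d_def u v cs_Q_def by algebra
  moreover have "a * ((1 - b)\<^sup>2 + (1 - b) * g1 + g1\<^sup>2) = c * v ^ 3 * H1 / (u ^ 5 * v ^ 5)"
    unfolding b g1 H1_def unfolding a_def using nz
    by (simp add: field_simps power2_eq_square power3_eq_cube numeral_eq_Suc)
  moreover have "(1 - a - b) * (g1\<^sup>2 + g1 * g2 + g2\<^sup>2) = (u * v - c * v - d * u) * H2 / (u ^ 5 * v ^ 5)"
  proof -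
    have "1 - a - b = (u * v - c * v - d * u) / (u * v)"
      unfolding a_def b_def d_def using nz by (simp add: field_simps)
    moreover have "g1\<^sup>2 + g1 * g2 + g2\<^sup>2 = H2 / (u ^ 4 * v ^ 4)"
      unfolding g1 g2 H2_def using nz by (simp add: field_simps numeral_eq_Suc)
    ultimately show ?thesis by (simp add: numeral_eq_Suc mult_ac)
  qed
  moreover have "b * (g2\<^sup>2 + g2 * (1 - a) + (1 - a)\<^sup>2) = d * u ^ 3 * H3 / (u ^ 5 * v ^ 5)"
    unfolding a g2 H3_def unfolding b_def d_def[symmetric] using nz
    by (simp add: field_simps numeral_eq_Suc)
  moreover have "cs_kappa2 \<tau> c = - (c * d * cs_Q \<tau> c * u\<^sup>2 * v\<^sup>2) / (3 * (u ^ 5 * v ^ 5))"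
    unfolding cs_kappa2_def u' v' d_def[symmetric] using nz
    by (simp add: field_simps numeral_eq_Suc)
  moreover have "(2 - a - b)\<^sup>2 = 3 * u ^ 3 * v ^ 3 * (2 * u * v - c * v - d * u)\<^sup>2 / (3 * (u ^ 5 * v ^ 5))"
  proof -
    have "2 - a - b = (2 * u * v - c * v - d * u) / (u * v)"
      unfolding a_def b_def d_def using nz by (simp add: field_simps)
    then show ?thesis using nz by (simp add: power_divide numeral_eq_Suc)
  qed
  ultimately show ?thesis
    by (simp add: add_divide_distrib[symmetric] diff_divide_distrib)
qed

text \<open>Three interior breakpoints serve both ranges of \<tau>, and they may coincide. Terms
  such as \<open>q1 * 0\<close> stay unsimplified so that the gluing rules unify with the
  claim.\<close>

lemma integral_four_affine_pieces:
  fixes f :: "real \<Rightarrow> real"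
  assumes meas [measurable]: "f \<in> borel_measurable borel"
    and bound: "\<And>x. \<bar>f x\<bar> \<le> B"
    and t: "0 \<le> t1" "t1 \<le> t2" "t2 \<le> t3" "t3 \<le> 1"
    and f1: "\<And>x. 0 < x \<Longrightarrow> x < t1 \<Longrightarrow> f x = p1 + q1 * x"
    and f2: "\<And>x. t1 < x \<Longrightarrow> x < t2 \<Longrightarrow> f x = p2 + q2 * x"
    and f3: "\<And>x. t2 < x \<Longrightarrow> x < t3 \<Longrightarrow> f x = p3 + q3 * x"
    and f4: "\<And>x. t3 < x \<Longrightarrow> x < 1 \<Longrightarrow> f x = p4 + q4 * x"
  shows "(\<integral>x. f x \<partial>unit_uniform)
      = (t1 - 0) * ((p1 + q1 * 0) + (p1 + q1 * t1)) / 2 + (t2 - t1) * ((p2 + q2 * t1) + (p2 + q2 * t2)) / 2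
      + (t3 - t2) * ((p3 + q3 * t2) + (p3 + q3 * t3)) / 2 + (1 - t3) * ((p4 + q4 * t3) + (p4 + q4 * 1)) / 2"
      (is ?mean)
    and "(\<integral>x. (f x)\<^sup>2 \<partial>unit_uniform)
      = (t1 - 0) * ((p1 + q1 * 0)\<^sup>2 + (p1 + q1 * 0) * (p1 + q1 * t1) + (p1 + q1 * t1)\<^sup>2) / 3
      + (t2 - t1) * ((p2 + q2 * t1)\<^sup>2 + (p2 + q2 * t1) * (p2 + q2 * t2) + (p2 + q2 * t2)\<^sup>2) / 3
      + (t3 - t2) * ((p3 + q3 * t2)\<^sup>2 + (p3 + q3 * t2) * (p3 + q3 * t3) + (p3 + q3 * t3)\<^sup>2) / 3
      + (1 - t3) * ((p4 + q4 * t3)\<^sup>2 + (p4 + q4 * t3) * (p4 + q4 * 1) + (p4 + q4 * 1)\<^sup>2) / 3"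
      (is ?square)
proof -
  have t': "0 \<le> t2" "0 \<le> t3" using t by auto
  show ?mean
    by (rule integral_unit_uniform[OF meas bound],
        intro has_integral_combine[OF t'(2) t(4)] has_integral_combine[OF t'(1) t(3)]
          has_integral_combine[OF t(1,2)] has_integral_affine t f1 f2 f3 f4)
  have bound2: "\<bar>(f x)\<^sup>2\<bar> \<le> B\<^sup>2" for x
    using power_mono[OF bound[of x], of 2] by simp
  show ?square
    by (rule integral_unit_uniform[OF _ bound2], measurable,
        intro has_integral_combine[OF t'(2) t(4)] has_integral_combine[OF t'(1) t(3)]
          has_integral_combine[OF t(1,2)] has_integral_affine_square t f1 f2 f3 f4)
qed

text \<open>Replacing \<open>c\<close> by \<open>1 - c\<close> only exchanges the two factors of the
  denominator, so the first formula serves every \<open>c\<close>.\<close>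

lemma cs_mu_eq_mu1: "cs_mu \<tau> c = cs_mu1 \<tau> c"
proof -
  have "1 + 2 * (1 - c) * (\<tau> - 1) * (1 - (1 - c)) = 1 + 2 * c * (\<tau> - 1) * (1 - c)"
    "2 * ((1 - c) * \<tau> - (1 - c) + 1) * (\<tau> + (1 - c) - (1 - c) * \<tau>)
      = 2 * (c * \<tau> - c + 1) * (\<tau> + c - c * \<tau>)"
    by (simp_all add: algebra_simps)
  then have "cs_mu1 \<tau> (1 - c) = cs_mu1 \<tau> c" by (simp only: cs_mu1_def)
  then show ?thesis by (simp add: cs_mu_def cs_mu2_def)
qed

lemma cs_nu_eq_nu1: "cs_nu \<tau> c = cs_nu1 \<tau> c"
proof -
  have "cs_kappa1 \<tau> (1 - c) = cs_kappa1 \<tau> c"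
  proof -
    have "3 * ((1 - c) * \<tau> - (1 - c) + 1) * ((1 - c) + \<tau> - (1 - c) * \<tau>)
        = 3 * (c * \<tau> - c + 1) * (c + \<tau> - c * \<tau>)"
      by (simp add: algebra_simps)
    moreover have "(1 - c)^2 * \<tau>^3 - 3 * (1 - c)^2 * \<tau>^2 - (1 - c) * \<tau>^3 + 2 * (1 - c)^2 * \<tau>
          + 3 * (1 - c) * \<tau>^2 - (1 - c)^2 - 2 * (1 - c) * \<tau> - \<tau>^2 + (1 - c) + \<tau>
        = c^2 * \<tau>^3 - 3 * c^2 * \<tau>^2 - c * \<tau>^3 + 2 * c^2 * \<tau> + 3 * c * \<tau>^2
           - c^2 - 2 * c * \<tau> - \<tau>^2 + c + \<tau>"
      by algebra
    ultimately show ?thesis by (simp only: cs_kappa1_def)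
  qed
  moreover have "cs_kappa2 \<tau> (1 - c) = cs_kappa2 \<tau> c"
  proof -
    have "cs_Q \<tau> (1 - c) = cs_Q \<tau> c" unfolding cs_Q_def by algebra
    moreover have "3 * ((1 - c) * \<tau> - (1 - c) + 1)^3 * ((1 - c) * \<tau> - (1 - c) - \<tau>)^3
        = 3 * (c * \<tau> - c + 1)^3 * (c * \<tau> - c - \<tau>)^3"
      by algebra
    moreover have "(1 - c) * (1 - (1 - c)) = c * (1 - c)" by simp
    ultimately show ?thesis by (simp only: cs_kappa2_def)
  qed
  ultimately have "cs_nu1 \<tau> (1 - c) = cs_nu1 \<tau> c" by (simp only: cs_nu1_def)
  then show ?thesis by (simp add: cs_nu_def cs_nu2_def)
qed

lemma affine_reflected: "r * (1 - x) = r + - r * x" for r x :: real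
  by (simp add: algebra_simps)

text \<open>Read forwards, this gives the form required for integration; read backwards, it
  evaluates a piece at its ends, where \<open>r * x\<close> and \<open>b * (1 - x)\<close> simplify
  at once.\<close>

lemma affine_sum_left:
  "r * x + (1 - a * x - b * (1 - x)) = 1 - b + (r - a + b) * x" for r x :: real
  by (simp add: algebra_simps)

lemma affine_sum_right:
  "r * (1 - x) + (1 - a * x - b * (1 - x)) = r + 1 - b + (b - r - a) * x" for r x :: real
  by (simp add: algebra_simps)

section \<open>Moments of the conditional means\<close>

context cs_parameters
begin

lemma row_measurable [measurable]: "row \<in> borel_measurable borel"
proof -
  interpret prob_space unit_uniform by (rule prob_space_unit_uniform)
  have "case_prod kernel \<in> borel_measurable (borel \<Otimes>\<^sub>M unit_uniform)" by measurable
  from borel_measurable_lebesgue_integral[OF this] show ?thesis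
    by (simp add: row_def[abs_def])
qed

lemma col_measurable [measurable]: "col \<in> borel_measurable borel"
proof -
  interpret prob_space unit_uniform by (rule prob_space_unit_uniform)
  have "(\<lambda>z. case_prod kernel (snd z, fst z)) \<in> borel_measurable (borel \<Otimes>\<^sub>M unit_uniform)"
    by measurable
  then have "(\<lambda>(y, x). kernel x y) \<in> borel_measurable (borel \<Otimes>\<^sub>M unit_uniform)"
    by (simp add: case_prod_beta)
  from borel_measurable_lebesgue_integral[OF this] show ?thesis
    by (simp add: col_def[abs_def])
qed

lemma kernel_bound: "\<bar>kernel x y\<bar> \<le> 1"
  by (simp add: kernel_def)

lemma row_bound: "\<bar>row x\<bar> \<le> 1"
  unfolding row_def
  by (rule prob_space.abs_integral_le_const[OF prob_space_unit_uniform]) (auto simp: kernel_bound)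

lemma col_bound: "\<bar>col x\<bar> \<le> 1"
  unfolding col_def
  by (rule prob_space.abs_integral_le_const[OF prob_space_unit_uniform]) (auto simp: kernel_bound)

lemma row_plus_col_bound: "\<bar>row x + col x\<bar> \<le> 2"
  using row_bound[of x] col_bound[of x] by linarith

lemma u_le_1: "\<tau> < 1 \<Longrightarrow> u \<le> 1"
  using mult_right_mono[of \<tau> 1 "1 - c"] c_less_1 by (simp add: u_def algebra_simps)

lemma c_times_le: "\<tau> < 1 \<Longrightarrow> c * (1 - \<tau>) \<le> c"
  using c_pos \<tau>_pos by (simp add: mult_le_cancel_left2)

lemma one_le_u: "1 \<le> \<tau> \<Longrightarrow> 1 \<le> u"
  using mult_right_mono[of 1 \<tau> "1 - c"] c_less_1 by (simp add: u_def algebra_simps)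

lemma one_le_v: "1 \<le> \<tau> \<Longrightarrow> 1 \<le> v"
  using mult_right_mono[of 1 \<tau> c] c_pos by (simp add: v_def)

lemma c_over_u_le: "1 \<le> \<tau> \<Longrightarrow> c / u \<le> c"
  using one_le_u c_pos u_pos by (simp add: divide_le_eq)

lemma c_le_right_break: "1 \<le> \<tau> \<Longrightarrow> c \<le> 1 - (1 - c) / v"
proof -
  assume "1 \<le> \<tau>"
  then have "(1 - c) * 1 \<le> (1 - c) * v" using one_le_v c_less_1 by (intro mult_left_mono) auto
  then have "(1 - c) / v \<le> 1 - c" using v_pos by (simp add: divide_le_eq)
  then show ?thesis by simp
qed

text \<open>The partial fraction form of the mean. It matches a trapezoid of height 1 with ramps of
  widths \<open>c / u\<close> and \<open>(1 - c) / v\<close>, which is the graph of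
  \<open>row\<close>.\<close>

lemma mu_large:
  assumes "1 \<le> \<tau>"
  shows "2 * cs_mu \<tau> c = 2 - c / u - (1 - c) / v"
proof -
  have uv: "c * \<tau> - c + 1 = v" "\<tau> + c - c * \<tau> = u"
    by (simp_all add: u_def v_def algebra_simps)
  have "cs_mu \<tau> c = \<tau> * (1 + 2 * c * (\<tau> - 1) * (1 - c)) / (2 * v * u)"
    using assms by (simp add: cs_mu_eq_mu1 cs_mu1_def uv)
  also have "\<tau> * (1 + 2 * c * (\<tau> - 1) * (1 - c)) = 2 * u * v - c * v - (1 - c) * u"
    by (simp add: u_def v_def algebra_simps)
  finally show ?thesis
    using u_pos v_pos by (simp add: field_simps)
qed

lemma integral_row: "(\<integral>x. row x \<partial>unit_uniform) = cs_mu \<tau> c"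
proof (cases "\<tau> < 1")
  case True
  \<comment> \<open>A triangle of height \<tau> with its peak at \<open>c\<close>: all three
    breakpoints are \<open>c\<close>, and the middle two pieces are empty.\<close>
  have "(\<integral>x. row x \<partial>unit_uniform)
      = (c - 0) * ((0 + \<tau> / c * 0) + (0 + \<tau> / c * c)) / 2 + (c - c) * ((0 + 0 * c) + (0 + 0 * c)) / 2
      + (c - c) * ((0 + 0 * c) + (0 + 0 * c)) / 2
      + (1 - c) * ((\<tau> / (1 - c) + - (\<tau> / (1 - c)) * c) + (\<tau> / (1 - c) + - (\<tau> / (1 - c)) * 1)) / 2"
  proof (rule integral_four_affine_pieces(1)[OF row_measurable row_bound])
    show "row x = \<tau> / (1 - c) + - (\<tau> / (1 - c)) * x" if "c < x" "x < 1" for x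
      unfolding row_small_right[OF True that] by (rule affine_reflected)
  qed (use c_pos c_less_1 True in \<open>auto simp: row_small_left\<close>)
  also have "\<dots> = \<tau> / 2"
  proof -
    have "\<tau> / (1 - c) + - (\<tau> / (1 - c)) * c = \<tau>"
      unfolding affine_reflected[symmetric] using c_less_1 by simp
    then show ?thesis
      using c_pos by (simp only:) (simp add: field_simps)
  qed
  finally show ?thesis using True by (simp add: cs_mu_eq_mu1 cs_mu1_def)
next
  case False
  then have \<tau>: "1 \<le> \<tau>" by simp
  let ?b = "1 - (1 - c) / v"
  \<comment> \<open>The plateau is cut at \<open>c\<close>, the point that
    \<open>row_large_middle\<close> excludes.\<close>
  have "(\<integral>x. row x \<partial>unit_uniform)
      = (c / u - 0) * ((0 + u / c * 0) + (0 + u / c * (c / u))) / 2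
      + (c - c / u) * ((1 + 0 * (c / u)) + (1 + 0 * c)) / 2
      + (?b - c) * ((1 + 0 * c) + (1 + 0 * ?b)) / 2
      + (1 - ?b) * ((v / (1 - c) + - (v / (1 - c)) * ?b) + (v / (1 - c) + - (v / (1 - c)) * 1)) / 2"
  proof (rule integral_four_affine_pieces(1)[OF row_measurable row_bound])
    show "row x = v / (1 - c) + - (v / (1 - c)) * x" if "?b < x" "x < 1" for x
      unfolding row_large_right[OF \<tau> that] by (rule affine_reflected)
    show "row x = 1 + 0 * x" if "c / u < x" "x < c" for x
      using row_large_middle[OF \<tau>, of x] that c_le_right_break[OF \<tau>] by simp
    show "row x = 1 + 0 * x" if "c < x" "x < ?b" for x
      using row_large_middle[OF \<tau>, of x] that c_over_u_le[OF \<tau>] by simp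
  qed (use c_over_u c_over_v c_over_u_le[OF \<tau>] c_le_right_break[OF \<tau>] row_large_left[OF \<tau>] in auto)
  also have "\<dots> = (2 - c / u - (1 - c) / v) / 2"
  proof -
    have e1: "0 + u / c * (c / u) = 1"
      using c_pos u_pos by simp
    have e2: "v / (1 - c) + - (v / (1 - c)) * ?b = 1"
      unfolding affine_reflected[symmetric] using c_less_1 v_pos by simp
    have "(a - 0) * ((0 + r * 0) + 1) / 2 + (c - a) * ((1 + 0 * a) + (1 + 0 * c)) / 2
        + (1 - b - c) * ((1 + 0 * c) + (1 + 0 * (1 - b))) / 2
        + (1 - (1 - b)) * (1 + (s + - s * 1)) / 2 = (2 - a - b) / 2" for a b r s :: real
      by (simp add: field_simps)
    then show ?thesis unfolding e1 e2 by blast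
  qed
  also have "\<dots> = cs_mu \<tau> c"
    using mu_large[OF \<tau>] by simp
  finally show ?thesis .
qed

text \<open>Additivity of the integral in end-value form; it removes the artificial cut at
  \<open>c\<close>.\<close>

lemma affine_square_split:
  fixes p q :: real
  shows "(s - r) * ((p + q * r)\<^sup>2 + (p + q * r) * (p + q * s) + (p + q * s)\<^sup>2) / 3
    + (t - s) * ((p + q * s)\<^sup>2 + (p + q * s) * (p + q * t) + (p + q * t)\<^sup>2) / 3
    = (t - r) * ((p + q * r)\<^sup>2 + (p + q * r) * (p + q * t) + (p + q * t)\<^sup>2) / 3"
  by (simp add: field_simps power2_eq_square)

text \<open>Variance plus squared mean: the sum of the conditional means has mean
  \<open>2 * cs_mu \<tau> c\<close>.\<close>

lemma integral_row_plus_col_square: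
  "(\<integral>x. (row x + col x)\<^sup>2 \<partial>unit_uniform) = 4 * cs_nu \<tau> c + 4 * (cs_mu \<tau> c)\<^sup>2"
proof (cases "\<tau> < 1")
  case True
  \<comment> \<open>Coefficients of the four pieces; the outer two vanish at 0 and at 1, so a slope
    determines each.\<close>
  let ?p2 = "1 - (1 - c) / v" and ?q2 = "\<tau> / c - c / u + (1 - c) / v"
  let ?p3 = "\<tau> / (1 - c) + 1 - (1 - c) / v" and ?q3 = "(1 - c) / v - \<tau> / (1 - c) - c / u"
  let ?q1 = "\<tau> / c + (1 / (1 - \<tau>) - c / u)"
  let ?q4 = "\<tau> / (1 - c) + (1 / (1 - \<tau>) - (1 - c) / v)"
  let ?t = "c * (1 - \<tau>)"
  have "(\<integral>x. (row x + col x)\<^sup>2 \<partial>unit_uniform)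
      = (?t - 0) * ((0 + ?q1 * 0)\<^sup>2 + (0 + ?q1 * 0) * (0 + ?q1 * ?t) + (0 + ?q1 * ?t)\<^sup>2) / 3
      + (c - ?t) * ((?p2 + ?q2 * ?t)\<^sup>2 + (?p2 + ?q2 * ?t) * (?p2 + ?q2 * c) + (?p2 + ?q2 * c)\<^sup>2) / 3
      + (u - c) * ((?p3 + ?q3 * c)\<^sup>2 + (?p3 + ?q3 * c) * (?p3 + ?q3 * u) + (?p3 + ?q3 * u)\<^sup>2) / 3
      + (1 - u) * ((?q4 + - ?q4 * u)\<^sup>2 + (?q4 + - ?q4 * u) * (?q4 + - ?q4 * 1) + (?q4 + - ?q4 * 1)\<^sup>2) / 3"
  proof (rule integral_four_affine_pieces(2)[OF _ row_plus_col_bound])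
    show "0 \<le> ?t" using True c_pos by simp
    show "?t \<le> c" by (rule c_times_le[OF True])
    show "c \<le> u" using u_gt by simp
    show "u \<le> 1" by (rule u_le_1[OF True])
    have ucl: "c < u" by (rule u_gt)
    show "row x + col x = 0 + ?q1 * x" if "0 < x" "x < ?t" for x
      using row_small_left[OF True, of x] col_small_left[OF True that] that \<open>?t \<le> c\<close>
      by (simp add: distrib_right)
    show "row x + col x = ?p2 + ?q2 * x" if "?t < x" "x < c" for x
    proof -
      have "0 < x" using that(1) \<open>0 \<le> ?t\<close> by linarith
      then show ?thesis
        using row_small_left[OF True, of x] col_middle[of x] that ucl c_less_1
        by (simp add: affine_sum_left[symmetric])
    qed
    show "row x + col x = ?p3 + ?q3 * x" if "c < x" "x < u" for x
      using row_small_right[OF True, of x] col_middle[of x] that \<open>?t \<le> c\<close> \<open>u \<le> 1\<close> c_pos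
      by (simp add: affine_sum_right[symmetric])
    show "row x + col x = ?q4 + - ?q4 * x" if "u < x" "x < 1" for x
      using row_small_right[OF True, of x] col_small_right[OF True, of x] that ucl
      by (simp only: affine_reflected[symmetric] distrib_right less_trans[OF ucl])
  qed measurable
  also have "\<dots> = c * (1 - \<tau>) * (0 + ?q1 * ?t)\<^sup>2 / 3
      + c * \<tau> * ((?p2 + ?q2 * ?t)\<^sup>2 + (?p2 + ?q2 * ?t) * (?p2 + ?q2 * c) + (?p2 + ?q2 * c)\<^sup>2) / 3
      + (1 - c) * \<tau> * ((?p3 + ?q3 * c)\<^sup>2 + (?p3 + ?q3 * c) * (?p3 + ?q3 * u) + (?p3 + ?q3 * u)\<^sup>2) / 3
      + (1 - c) * (1 - \<tau>) * (?q4 + - ?q4 * u)\<^sup>2 / 3"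
  proof -
    have "?t - 0 = c * (1 - \<tau>)" "c - ?t = c * \<tau>" "u - c = (1 - c) * \<tau>" "1 - u = (1 - c) * (1 - \<tau>)"
      "0 + ?q1 * 0 = 0" "?q4 + - ?q4 * 1 = 0"
      by (simp_all add: u_def algebra_simps)
    then show ?thesis by (simp only:) simp
  qed
  also have "\<dots> = cs_kappa1 \<tau> c + \<tau>\<^sup>2"
  proof -
    have ne: "c \<noteq> 0" "1 - c \<noteq> 0" "1 - \<tau> \<noteq> 0" "u \<noteq> 0" "v \<noteq> 0"
      using c_pos c_less_1 True u_pos v_pos by auto
    have w: "(1 - c) / v * (1 - ?t) = 1 - c"
    proof -
      have "1 - ?t = v" by (simp add: v_def algebra_simps)
      then show ?thesis using ne by simp
    qed
    have z: "c / u * u = c" using ne by simp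
    have s1: "\<tau> / c * ?t = \<tau> * (1 - \<tau>)" "1 / (1 - \<tau>) * ?t = c" "\<tau> / c * c = \<tau>"
      using ne by auto
    have s2: "\<tau> / (1 - c) * (1 - u) = \<tau> * (1 - \<tau>)" "1 / (1 - \<tau>) * (1 - u) = 1 - c"
      "\<tau> / (1 - c) * (1 - c) = \<tau>" "(1 - c) / v * (1 - u) = (1 - c) / v * ((1 - c) * (1 - \<tau>))"
    proof -
      have "1 - u = (1 - c) * (1 - \<tau>)" by (simp add: u_def algebra_simps)
      then show "\<tau> / (1 - c) * (1 - u) = \<tau> * (1 - \<tau>)" "1 / (1 - \<tau>) * (1 - u) = 1 - c"
        "\<tau> / (1 - c) * (1 - c) = \<tau>" "(1 - c) / v * (1 - u) = (1 - c) / v * ((1 - c) * (1 - \<tau>))"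
        using ne by simp_all
    qed
    \<comment> \<open>The end values from the two sides of each breakpoint agree, leaving exactly
      the three numbers of \<open>kappa1_identity\<close>.\<close>
    have e1: "0 + ?q1 * ?t = \<tau> * (1 - \<tau>) + c - c / u * ?t"
      using s1 by (simp only: distrib_right left_diff_distrib)
    have e2: "?p2 + ?q2 * ?t = \<tau> * (1 - \<tau>) + c - c / u * ?t"
      unfolding affine_sum_left[symmetric] s1 w by simp
    have e3: "?p2 + ?q2 * c = \<tau> + 1 - c / u * c - (1 - c) / v * (1 - c)"
      unfolding affine_sum_left[symmetric] s1 by simp
    have e4: "?p3 + ?q3 * c = \<tau> + 1 - c / u * c - (1 - c) / v * (1 - c)"
      unfolding affine_sum_right[symmetric] s2 by simp
    have e5: "?p3 + ?q3 * u = \<tau> * (1 - \<tau>) + (1 - c) - (1 - c) / v * ((1 - c) * (1 - \<tau>))"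
      unfolding affine_sum_right[symmetric] s2 z by simp
    have e6: "?q4 + - ?q4 * u = \<tau> * (1 - \<tau>) + (1 - c) - (1 - c) / v * ((1 - c) * (1 - \<tau>))"
      unfolding affine_reflected[symmetric] distrib_right left_diff_distrib s2 by simp
    show ?thesis
      unfolding e1 e2 e3 e4 e5 e6 by (rule kappa1_identity[OF u_def v_def ne(4,5)])
  qed
  finally show ?thesis
    using True by (simp add: cs_nu_eq_nu1 cs_nu1_def cs_mu_eq_mu1 cs_mu1_def power_divide)
next
  case False
  then have \<tau>: "1 \<le> \<tau>" by simp
  define a b where "a = c / u" and "b = (1 - c) / v"
  have nz: "u \<noteq> 0" "v \<noteq> 0" using u_pos v_pos by auto
  have a: "0 < a" "a \<le> c" and b: "0 < b" "c \<le> 1 - b"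
    using c_over_u(1) c_over_v(1) c_over_u_le[OF \<tau>] c_le_right_break[OF \<tau>]
    by (simp_all add: a_def b_def)
  have ua: "u / c * a = 1" and vb: "v / (1 - c) * b = 1"
    using u_pos v_pos c_pos c_less_1 by (simp_all add: a_def b_def)
  have col: "col x = 1 - a * x - b * (1 - x)" if "0 < x" "x < 1" for x
    using col_middle[of x] that \<tau> by (simp add: a_def b_def)
  let ?q1 = "u / c - a + b" and ?p4 = "v / (1 - c) + 1 - b" and ?q4 = "b - v / (1 - c) - a"
  have "(\<integral>x. (row x + col x)\<^sup>2 \<partial>unit_uniform)
      = (a - 0) * ((1 - b + ?q1 * 0)\<^sup>2 + (1 - b + ?q1 * 0) * (1 - b + ?q1 * a) + (1 - b + ?q1 * a)\<^sup>2) / 3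
      + (c - a) * ((2 - b + (b - a) * a)\<^sup>2 + (2 - b + (b - a) * a) * (2 - b + (b - a) * c) + (2 - b + (b - a) * c)\<^sup>2) / 3
      + (1 - b - c) * ((2 - b + (b - a) * c)\<^sup>2 + (2 - b + (b - a) * c) * (2 - b + (b - a) * (1 - b)) + (2 - b + (b - a) * (1 - b))\<^sup>2) / 3
      + (1 - (1 - b)) * ((?p4 + ?q4 * (1 - b))\<^sup>2 + (?p4 + ?q4 * (1 - b)) * (?p4 + ?q4 * 1) + (?p4 + ?q4 * 1)\<^sup>2) / 3"
  proof (rule integral_four_affine_pieces(2)[OF _ row_plus_col_bound])
    show "row x + col x = 1 - b + ?q1 * x" if "0 < x" "x < a" for x
      using row_large_left[OF \<tau>, of x] col[of x] that a(2) c_less_1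
      by (simp add: a_def[symmetric] algebra_simps)
    show "row x + col x = 2 - b + (b - a) * x" if "a < x" "x < c" for x
      using row_large_middle[OF \<tau>, of x] col[of x] that a b c_less_1
      by (simp add: a_def[symmetric] b_def[symmetric] algebra_simps)
    show "row x + col x = 2 - b + (b - a) * x" if "c < x" "x < 1 - b" for x
      using row_large_middle[OF \<tau>, of x] col[of x] that a b c_pos
      by (simp add: a_def[symmetric] b_def[symmetric] algebra_simps)
    show "row x + col x = ?p4 + ?q4 * x" if "1 - b < x" "x < 1" for x
    proof -
      have "row x = v / (1 - c) * (1 - x)" "col x = 1 - a * x - b * (1 - x)"
        using row_large_right[OF \<tau>, of x] col[of x] that b c_pos by (simp_all add: b_def)
      then show ?thesis by (simp only: affine_sum_right)
    qed
  qed (use a b in auto)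
  also have "\<dots> = a * ((1 - b)\<^sup>2 + (1 - b) * (1 - b + ?q1 * a) + (1 - b + ?q1 * a)\<^sup>2) / 3
      + ((1 - b) - a) * ((2 - b + (b - a) * a)\<^sup>2 + (2 - b + (b - a) * a) * (2 - b + (b - a) * (1 - b)) + (2 - b + (b - a) * (1 - b))\<^sup>2) / 3
      + b * ((?p4 + ?q4 * (1 - b))\<^sup>2 + (?p4 + ?q4 * (1 - b)) * (?p4 + ?q4 * 1) + (?p4 + ?q4 * 1)\<^sup>2) / 3"
    using affine_square_split[of c a "2 - b" "b - a" "1 - b"] by simp
  also have "\<dots> = cs_kappa2 \<tau> c + (2 - a - b)\<^sup>2"
  proof -
    have e1: "1 - b + ?q1 * a = 2 - a * a - b * (1 - a)"
      unfolding affine_sum_left[symmetric] ua by simp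
    have e2: "2 - b + (b - a) * a = 2 - a * a - b * (1 - a)"
      by (simp add: algebra_simps)
    have e3: "2 - b + (b - a) * (1 - b) = 2 - a * (1 - b) - b * b"
      by (simp add: algebra_simps)
    have bb: "1 - (1 - b) = b" by simp
    have e4: "?p4 + ?q4 * (1 - b) = 2 - a * (1 - b) - b * b"
      unfolding affine_sum_right[symmetric] bb vb by simp
    have e5: "?p4 + ?q4 * 1 = 1 - a" by simp
    have e6: "(1 - b) - a = 1 - a - b" by simp
    show ?thesis
      unfolding e1 e2 e3 e4 e5 e6 unfolding a_def b_def
      by (rule kappa2_identity[OF u_def v_def nz])
  qed
  also have "2 - a - b = 2 * cs_mu \<tau> c"
    by (simp add: mu_large[OF \<tau>] a_def b_def)
  finally show ?thesis
    using False by (simp add: cs_nu_eq_nu1 cs_nu1_def power_mult_distrib)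
qed

text \<open>The limit law requires a positive standard deviation, and the sign of the polynomials is
  hard to see. Near 0 the slope is positive because \<open>1 / (1 - \<tau>)\<close>, respectively
  \<open>u / c\<close>, exceeds 1 while \<open>c / u\<close> is below 1; \<open>m\<close> only
  shifts the intercept.\<close>

lemma integral_centered_square_pos:
  "0 < (\<integral>x. (row x + col x - 2 * m)\<^sup>2 \<partial>unit_uniform)"
proof (cases "\<tau> < 1")
  case True
  have "1 < 1 / (1 - \<tau>)" using True \<tau>_pos by simp
  then have "0 < \<tau> / c + (1 / (1 - \<tau>) - c / u)"
    using c_over_u(2) c_pos \<tau>_pos by (simp add: add_pos_pos)
  show ?thesis
  proof (rule integral_unit_uniform_square_pos[where a = 0 and b = "c * (1 - \<tau>)"
        and p = "- 2 * m" and q = "\<tau> / c + (1 / (1 - \<tau>) - c / u)" and B = "2 + \<bar>2 * m\<bar>"])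
    show "\<bar>row x + col x - 2 * m\<bar> \<le> 2 + \<bar>2 * m\<bar>" for x
      using row_plus_col_bound[of x] by linarith
    show "c * (1 - \<tau>) \<le> 1" using c_times_le[OF True] c_less_1 by simp
    show "row x + col x - 2 * m = - 2 * m + (\<tau> / c + (1 / (1 - \<tau>) - c / u)) * x"
      if "0 < x" "x < c * (1 - \<tau>)" for x
      using row_small_left[OF True, of x] col_small_left[OF True that] that c_times_le[OF True]
      by (simp add: distrib_right)
  qed (use c_pos True \<open>0 < \<tau> / c + (1 / (1 - \<tau>) - c / u)\<close> in auto)
next
  case False
  then have \<tau>: "1 \<le> \<tau>" by simp
  have "1 < u / c" using u_gt c_pos by simp
  then have q: "0 < u / c - c / u + (1 - c) / v"
    using c_over_u(2) c_over_v(1) by linarith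
  show ?thesis
  proof (rule integral_unit_uniform_square_pos[where a = 0 and b = "c / u"
        and p = "1 - (1 - c) / v - 2 * m" and q = "u / c - c / u + (1 - c) / v" and B = "2 + \<bar>2 * m\<bar>"])
    show "\<bar>row x + col x - 2 * m\<bar> \<le> 2 + \<bar>2 * m\<bar>" for x
      using row_plus_col_bound[of x] by linarith
    show "row x + col x - 2 * m = 1 - (1 - c) / v - 2 * m + (u / c - c / u + (1 - c) / v) * x"
      if "0 < x" "x < c / u" for x
      using row_large_left[OF \<tau> that] col_middle[of x] that \<tau> c_over_u(2)
        affine_sum_left[of "u / c" x "c / u" "(1 - c) / v"]
      by (simp del: times_divide_eq_left times_divide_eq_right)
  qed (use c_over_u q in auto)
qed

end

section \<open>Transfer to the original interval\<close>

lemma distr_uniform_measure_unit: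
  assumes "y1 < y2"
  shows "distr (uniform_measure lborel {y1<..<y2}) borel (\<lambda>x. (x - y1) / (y2 - y1)) = unit_uniform"
proof (rule measure_eqI)
  define w where "w = y2 - y1"
  have w: "0 < w" using assms by (simp add: w_def)
  fix A :: "real set" assume "A \<in> sets (distr (uniform_measure lborel {y1<..<y2}) borel (\<lambda>x. (x - y1) / (y2 - y1)))"
  then have A [measurable]: "A \<in> sets borel" by simp
  let ?f = "\<lambda>x. (x - y1) / w"
  have [measurable]: "?f -` A \<in> sets borel"
    using measurable_sets[of ?f borel borel A] by simp
  have "emeasure lborel ({y1<..<y2} \<inter> ?f -` A)
      = (\<integral>\<^sup>+x. indicator ({y1<..<y2} \<inter> ?f -` A) x \<partial>lborel)"
    by simp
  \<comment> \<open>The Jacobian \<open>w\<close> of the substitution cancels the length of the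
    interval in the normalisation of the uniform law.\<close>
  also have "\<dots> = ennreal w * (\<integral>\<^sup>+x. indicator ({y1<..<y2} \<inter> ?f -` A) (y1 + w * x) \<partial>lborel)"
    using nn_integral_real_affine[of "indicator ({y1<..<y2} \<inter> ?f -` A)" w y1] w by simp
  also have "(\<lambda>x. indicator ({y1<..<y2} \<inter> ?f -` A) (y1 + w * x) :: ennreal) = indicator ({0<..<1} \<inter> A)"
  proof
    fix x
    have "y1 + w * x < y2 \<longleftrightarrow> x < 1"
      using mult_less_cancel_left_pos[OF w, of x 1] by (auto simp: w_def)
    then show "indicator ({y1<..<y2} \<inter> ?f -` A) (y1 + w * x) = (indicator ({0<..<1} \<inter> A) x :: ennreal)"
      using w by (auto simp: indicator_def zero_less_mult_iff)
  qed
  finally have *: "emeasure lborel ({y1<..<y2} \<inter> ?f -` A) = ennreal w * emeasure lborel ({0<..<1} \<inter> A)"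
    by simp
  have "emeasure (distr (uniform_measure lborel {y1<..<y2}) borel (\<lambda>x. (x - y1) / (y2 - y1))) A
      = emeasure lborel ({y1<..<y2} \<inter> ?f -` A) / ennreal w"
    using assms measurable_sets[of "\<lambda>x. (x - y1) / (y2 - y1)" borel borel A]
    by (subst emeasure_distr) (auto simp: w_def)
  also have "\<dots> = emeasure lborel ({0<..<1} \<inter> A)"
    unfolding * using w by (subst mult.commute) (simp add: ennreal_mult_divide_eq)
  also have "\<dots> = emeasure unit_uniform A"
    by (simp add: divide_ennreal_def)
  finally show "emeasure (distr (uniform_measure lborel {y1<..<y2}) borel (\<lambda>x. (x - y1) / (y2 - y1))) A
      = emeasure unit_uniform A" .
qed simp

text \<open>The arcs form a filtered set of index pairs, so their number is a sum of indicators; the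
  affine invariance of the regions moves these to the unit interval.\<close>

lemma relative_density_cs_pcd:
  assumes "y1 < y2"
  shows "relative_density (cs_pcd b y1 y2 \<tau> c n P) =
    (\<Sum>(i, j)\<in>off_diagonal n. of_bool ((P j - y1) / (y2 - y1) \<in> cs_region b 0 1 \<tau> c ((P i - y1) / (y2 - y1))))
      / (real n * (real n - 1))"
proof -
  have "parcs (cs_pcd b y1 y2 \<tau> c n P)
      = off_diagonal n \<inter> {e. P (snd e) \<in> cs_region b y1 y2 \<tau> c (P (fst e))}"
    by (auto simp: cs_pcd_def off_diagonal_iff)
  then have "real (card (parcs (cs_pcd b y1 y2 \<tau> c n P)))
      = (\<Sum>e\<in>off_diagonal n. of_bool (P (snd e) \<in> cs_region b y1 y2 \<tau> c (P (fst e))))"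
    by (simp add: sum_of_bool_eq)
  then show ?thesis
    by (simp add: relative_density_def cs_pcd_def case_prod_beta cs_region_rescale[OF assms, symmetric])
qed

theorem theorem4p7:
  fixes M :: "'a measure" and X :: "nat \<Rightarrow> 'a \<Rightarrow> real"
    and y1 y2 \<tau> c :: real and left_at_centre :: bool
  assumes "prob_space M"
    and "y1 < y2"
    and "prob_space.indep_vars M (\<lambda>_. borel) X UNIV"
    and "\<And>i. distr M borel (X i) = uniform_measure lborel {y1<..<y2}"
    and "0 < c" and "c < 1"
    and "0 < \<tau>"
  shows "weak_conv_m
    (\<lambda>n. distr M borel (\<lambda>\<omega>. sqrt (real n) *
       (relative_density (cs_pcd left_at_centre y1 y2 \<tau> c n (\<lambda>i. X i \<omega>)) - cs_mu \<tau> c)))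
    (density lborel (normal_density 0 (sqrt (4 * cs_nu \<tau> c))))"
proof -
  interpret prob_space M by fact
  interpret cs: cs_parameters left_at_centre \<tau> c
    by unfold_locales fact+
  let ?s = "\<lambda>x. (x - y1) / (y2 - y1)"
  define U where "U i \<omega> = ?s (X i \<omega>)" for i \<omega>
  have X_rv [measurable]: "random_variable borel (X i)" for i
    using assms(3) unfolding indep_vars_def2 by simp
  interpret iid_kernel M borel U unit_uniform cs.kernel
  proof unfold_locales
    show "indep_vars (\<lambda>_. borel) U UNIV"
      unfolding U_def[abs_def] by (rule indep_vars_compose2[OF assms(3)]) simp
    show "distr M borel (U i) = unit_uniform" for i
      using distr_distr[of ?s borel borel "X i" M] distr_uniform_measure_unit[OF \<open>y1 < y2\<close>]
      by (simp add: U_def[abs_def] comp_def assms(4))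
  qed (use cs.kernel_measurable cs.kernel_bound in auto)
  have row: "row_mean = cs.row" and col: "col_mean = cs.col"
    by (simp_all add: fun_eq_iff row_mean_def col_mean_def cs.row_def cs.col_def)
  have mean: "kernel_mean = cs_mu \<tau> c"
    by (simp add: kernel_mean_def row cs.integral_row)
  let ?g = "\<lambda>x. cs.row x + cs.col x" and ?m = "cs_mu \<tau> c"
  \<comment> \<open>Since \<open>?g\<close> has mean \<open>2 * ?m\<close>, its second moment minus
    \<open>4 * ?m\<^sup>2\<close> remains, which cancels the mean term of
    \<open>integral_row_plus_col_square\<close>.\<close>
  have "(\<integral>x. (projection x)\<^sup>2 \<partial>unit_uniform)
      = (\<integral>x. (?g x)\<^sup>2 - 4 * ?m * ?g x + 4 * ?m\<^sup>2 \<partial>unit_uniform)"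
    by (simp add: projection_def row col mean power2_eq_square algebra_simps)
  also have "\<dots> = (\<integral>x. (?g x)\<^sup>2 \<partial>unit_uniform) - 4 * ?m * (\<integral>x. ?g x \<partial>unit_uniform) + 4 * ?m\<^sup>2"
  proof -
    have "integrable unit_uniform (\<lambda>x. (?g x)\<^sup>2)"
    proof (rule D.integrable_const_bound[of _ 4])
      show "AE x in unit_uniform. norm ((?g x)\<^sup>2) \<le> 4"
      proof (rule AE_I2)
        show "norm ((?g x)\<^sup>2) \<le> 4" for x
          using power_mono[OF cs.row_plus_col_bound[of x], of 2] by simp
      qed
    qed simp
    moreover have "integrable unit_uniform ?g"
      using integrable_row_mean integrable_col_mean by (simp add: row col)
    ultimately show ?thesis using D.prob_space by simp
  qed
  also have "(\<integral>x. ?g x \<partial>unit_uniform) = 2 * ?m"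
    using integrable_row_mean integrable_col_mean integral_col_mean
    by (simp add: row col mean cs.integral_row)
  finally have var: "(\<integral>x. (projection x)\<^sup>2 \<partial>unit_uniform) = 4 * cs_nu \<tau> c"
    using cs.integral_row_plus_col_square by (simp add: power2_eq_square)
  \<comment> \<open>Positivity is read off the integral form; it makes the square root a valid
    standard deviation whose square is the variance.\<close>
  then have "0 < 4 * cs_nu \<tau> c"
    using cs.integral_centered_square_pos[of ?m] by (simp add: projection_def row col mean)
  then have "weak_conv_m (\<lambda>n. distr M borel (\<lambda>\<omega>. sqrt (real n) * (u_statistic n \<omega> - kernel_mean)))
      (density lborel (normal_density 0 (sqrt (4 * cs_nu \<tau> c))))"
    by (intro u_statistic_clt) (simp_all add: var)
  moreover have "u_statistic n \<omega> = relative_density (cs_pcd left_at_centre y1 y2 \<tau> c n (\<lambda>i. X i \<omega>))" for n \<omega>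
    by (simp add: relative_density_cs_pcd[OF \<open>y1 < y2\<close>] u_statistic_def U_def cs.kernel_def)
  ultimately show ?thesis by (simp add: mean)
qed

end
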